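(* Let $(T,F)$ be a rooted tree (with a unique sink or with a unique source) over $(Q,\rho)$, and let $M:=M(T,F)$ be the associated rooted tree module over $\Lambda=\mathcal KQ/\langle\rho\rangle$. Then the following are equivalent: (1) $M$ is indecomposable; (2) there is no non-identity idempotent quiver morphism $\iota:T\to T$ satisfying $F\circ\iota=F$.
   Context: Fix a field $\mathcal K$ with $\mathrm{char}(\mathcal K)\neq 2$. Let $Q=(Q_0,Q_1,\varsigma,\varepsilon)$ be a quiver ($\varsigma$, $\varepsilon$ are the source and target maps) and $\rho$ a set of paths in $Q$ of length at least $2$ that bounds the length of the paths, not lying in the ideal $\langle\rho\rangle$, passing through any vertex. Put $\Lambda:=\mathcal KQ/\langle\rho\rangle$ (a zero-relation algebra). Finite-dimensional $\Lambda$-modules are identified with finite-dimensional $\mathcal K$-representations of $(Q,\rho)$. A tree is a finite quiver $T=(T_0,T_1,s,t)$ whose underlying undirected graph is simply connected (connected without cycles). It is a rooted tree if it has a unique sink or a unique source, denoted $\ast$ and called the root. A quiver morphism is a pair of maps (on vertices and on arrows) commuting with sources and targets. A quiver morphism $F:T\to Q$ is bound, written $F:T\to(Q,\rho)$, if there is no path $p$ in $T$ with $F(p)\in\langle\rho\rangle$; then $(T,F)$ is called a tree over $(Q,\rho)$. A quiver morphism $\iota:T\to T$ is idempotent if $\iota\circ\iota=\iota$. The module $M(T,F)$ has $\mathcal K$-basis $\{v_n\mid n\in T_0\}$, with $v_n$ placed at the vertex $F(n)$ of $Q$, and an arrow $\gamma\in Q_1$ acts by $\gamma\cdot v_n=\sum_{a\in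 T_1,\ s(a)=n,\ F(a)=\gamma}v_{t(a)}$. If $T$ is a rooted tree, $M(T,F)$ is called a rooted tree module (RTM). *)

theory Defs
  imports
    "Graph_Theory.Graph_Theory"
    "HOL-Library.Poly_Mapping"
    "HOL-Computational_Algebra.Computational_Algebra"
begin

section \<open>Free vector spaces\<close>

text \<open>
  The free vector space over a field on a type of basis elements is the type of finitely
  supported functions; \<^term>\<open>bvec b\<close> is the basis vector belonging to \<^term>\<open>b\<close>.
\<close>

definition fscale :: "'k::field \<Rightarrow> ('b \<Rightarrow>\<^sub>0 'k) \<Rightarrow> ('b \<Rightarrow>\<^sub>0 'k)" where
  "fscale c x = Poly_Mapping.map (\<lambda>d. c * d) x"

definition bvec :: "'b \<Rightarrow> ('b \<Rightarrow>\<^sub>0 'k::field)" where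
  "bvec b = Poly_Mapping.single b 1"

lemma lookup_fscale [simp]: "Poly_Mapping.lookup (fscale c x) b = c * Poly_Mapping.lookup x b"
  by (simp add: fscale_def Poly_Mapping.map.rep_eq when_def)

lemma vector_space_fscale: "vector_space fscale"
  by unfold_locales (auto intro!: poly_mapping_eqI simp: lookup_add algebra_simps)


section \<open>Quivers, path algebras and zero relations\<close>

text \<open>
  A quiver is a (possibly infinite) multi-digraph, i.e. a \<^locale>\<open>wf_digraph\<close>.  A path is given
  by its starting vertex and the list of its arrows in the order in which they are traversed;
  the trivial path at a vertex has the empty list.
\<close>

type_synonym ('v, 'a) path = "'v \<times> 'a list"

definition paths :: "('v, 'a) pre_digraph \<Rightarrow> ('v, 'a) path set" where
  "paths Q = {(u, as). \<exists>w. pre_digraph.awalk Q u as w}"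

definition path_end :: "('v, 'a) pre_digraph \<Rightarrow> ('v, 'a) path \<Rightarrow> 'v" where
  "path_end Q p = pre_digraph.awlast Q (fst p) (snd p)"

definition path_verts :: "('v, 'a) pre_digraph \<Rightarrow> ('v, 'a) path \<Rightarrow> 'v set" where
  "path_verts Q p = set (pre_digraph.awalk_verts Q (fst p) (snd p))"

definition path_length :: "('v, 'a) path \<Rightarrow> nat" where
  "path_length p = length (snd p)"

text \<open>The path algebra \<open>KQ\<close>.  In a product \<open>p q\<close> of paths, \<open>q\<close> is traversed first.\<close>

definition path_algebra :: "('v, 'a) pre_digraph \<Rightarrow> (('v, 'a) path \<Rightarrow>\<^sub>0 'k::field) set" where
  "path_algebra Q = {x. Poly_Mapping.keys x \<subseteq> paths Q}"

definition path_mult ::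
    "('v, 'a) pre_digraph \<Rightarrow> (('v, 'a) path \<Rightarrow>\<^sub>0 'k::field) \<Rightarrow> (('v, 'a) path \<Rightarrow>\<^sub>0 'k) \<Rightarrow>
      (('v, 'a) path \<Rightarrow>\<^sub>0 'k)" where
  "path_mult Q x y =
    (\<Sum>p\<in>Poly_Mapping.keys x. \<Sum>q\<in>Poly_Mapping.keys y.
      if path_end Q q = fst p
      then Poly_Mapping.single (fst q, snd q @ snd p)
             (Poly_Mapping.lookup x p * Poly_Mapping.lookup y q)
      else 0)"

definition two_sided_ideal ::
    "('v, 'a) pre_digraph \<Rightarrow> (('v, 'a) path \<Rightarrow>\<^sub>0 'k::field) set \<Rightarrow> bool" where
  "two_sided_ideal Q I \<longleftrightarrow>
     I \<subseteq> path_algebra Q \<and> module.subspace fscale I \<and>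
     (\<forall>x\<in>path_algebra Q. \<forall>y\<in>I. path_mult Q x y \<in> I \<and> path_mult Q y x \<in> I)"

definition rel_ideal ::
    "('v, 'a) pre_digraph \<Rightarrow> ('v, 'a) path set \<Rightarrow> (('v, 'a) path \<Rightarrow>\<^sub>0 'k::field) set" where
  "rel_ideal Q \<rho> = two_sided_ideal Q hull (bvec ` \<rho>)"

text \<open>
  The ideal lives in the path algebra over a particular field, hence the type arguments
  in the following definitions.
\<close>

definition zero_path ::
    "'k::field itself \<Rightarrow> ('v, 'a) pre_digraph \<Rightarrow> ('v, 'a) path set \<Rightarrow> ('v, 'a) path \<Rightarrow> bool" where
  "zero_path _ Q \<rho> p \<longleftrightarrow> (bvec p :: ('v, 'a) path \<Rightarrow>\<^sub>0 'k) \<in> rel_ideal Q \<rho>"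

definition zero_relations ::
    "'k::field itself \<Rightarrow> ('v, 'a) pre_digraph \<Rightarrow> ('v, 'a) path set \<Rightarrow> bool" where
  "zero_relations K Q \<rho> \<longleftrightarrow>
     \<rho> \<subseteq> paths Q \<and> (\<forall>r\<in>\<rho>. 2 \<le> path_length r) \<and>
     (\<forall>x\<in>verts Q. \<exists>N. \<forall>p\<in>paths Q.
        \<not> zero_path K Q \<rho> p \<longrightarrow> x \<in> path_verts Q p \<longrightarrow> path_length p \<le> N)"


section \<open>Representations of a quiver with zero relations\<close>

text \<open>
  The spaces of a representation are subspaces of an ambient vector space with scalar
  multiplication \<^term>\<open>scale\<close>; only the spaces at vertices of \<^term>\<open>Q\<close> and the values of the
  structure maps of arrows of \<^term>\<open>Q\<close> on the spaces at their sources are relevant.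
\<close>

record ('v, 'a, 'm) quiver_rep =
  space_at :: "'v \<Rightarrow> 'm set"
  act :: "'a \<Rightarrow> 'm \<Rightarrow> 'm"

definition representation ::
    "('k::field \<Rightarrow> 'm::ab_group_add \<Rightarrow> 'm) \<Rightarrow> ('v, 'a) pre_digraph \<Rightarrow> ('v, 'a) path set \<Rightarrow>
      ('v, 'a, 'm) quiver_rep \<Rightarrow> bool" where
  "representation scale Q \<rho> V \<longleftrightarrow>
     vector_space scale \<and>
     (\<forall>x\<in>verts Q. module.subspace scale (space_at V x)) \<and>
     (\<forall>\<gamma>\<in>arcs Q. \<forall>m\<in>space_at V (tail Q \<gamma>).
        act V \<gamma> m \<in> space_at V (head Q \<gamma>) \<and>
        (\<forall>c. act V \<gamma> (scale c m) = scale c (act V \<gamma> m)) \<and>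
        (\<forall>m'\<in>space_at V (tail Q \<gamma>). act V \<gamma> (m + m') = act V \<gamma> m + act V \<gamma> m')) \<and>
     (\<forall>r\<in>\<rho>. \<forall>m\<in>space_at V (fst r). fold (act V) (snd r) m = 0)"

definition subrepresentation ::
    "('k::field \<Rightarrow> 'm::ab_group_add \<Rightarrow> 'm) \<Rightarrow> ('v, 'a) pre_digraph \<Rightarrow>
      ('v \<Rightarrow> 'm set) \<Rightarrow> ('v, 'a, 'm) quiver_rep \<Rightarrow> bool" where
  "subrepresentation scale Q A V \<longleftrightarrow>
     (\<forall>x\<in>verts Q. module.subspace scale (A x) \<and> A x \<subseteq> space_at V x) \<and>
     (\<forall>\<gamma>\<in>arcs Q. act V \<gamma> ` A (tail Q \<gamma>) \<subseteq> A (head Q \<gamma>))"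

definition zero_family :: "('v, 'a) pre_digraph \<Rightarrow> ('v \<Rightarrow> 'm::ab_group_add set) \<Rightarrow> bool" where
  "zero_family Q A \<longleftrightarrow> (\<forall>x\<in>verts Q. A x = {0})"

definition internal_direct_sum ::
    "('v, 'a) pre_digraph \<Rightarrow> ('v, 'a, 'm::ab_group_add) quiver_rep \<Rightarrow>
      ('v \<Rightarrow> 'm set) \<Rightarrow> ('v \<Rightarrow> 'm set) \<Rightarrow> bool" where
  "internal_direct_sum Q V A B \<longleftrightarrow>
     (\<forall>x\<in>verts Q. space_at V x = {a + b | a b. a \<in> A x \<and> b \<in> B x} \<and> A x \<inter> B x = {0})"

definition indecomposable ::
    "('k::field \<Rightarrow> 'm::ab_group_add \<Rightarrow> 'm) \<Rightarrow> ('v, 'a) pre_digraph \<Rightarrow> ('v, 'a) path set \<Rightarrow>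
      ('v, 'a, 'm) quiver_rep \<Rightarrow> bool" where
  "indecomposable scale Q \<rho> V \<longleftrightarrow>
     representation scale Q \<rho> V \<and> \<not> zero_family Q (space_at V) \<and>
     (\<forall>A B. subrepresentation scale Q A V \<longrightarrow> subrepresentation scale Q B V \<longrightarrow>
        internal_direct_sum Q V A B \<longrightarrow> zero_family Q A \<or> zero_family Q B)"


section \<open>Trees over a quiver\<close>

text \<open>
  In the double quiver every arrow \<open>a\<close> is accompanied by a formal inverse \<open>(a, False)\<close>.  Thus its
  walks are the walks in the underlying undirected multigraph, and a cycle there is a cycle of the
  double quiver using no arrow twice (in either direction); loops and pairs of parallel or
  antiparallel arrows count as cycles.  Note that \<^const>\<open>tree\<close> from the digraph library only
  excludes directed cycles.
\<close>

definition double_quiver :: "('v, 'a) pre_digraph \<Rightarrow> ('v, 'a \<times> bool) pre_digraph" where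
  "double_quiver T =
     \<lparr> verts = verts T, arcs = arcs T \<times> UNIV,
       tail = (\<lambda>(a, fwd). if fwd then tail T a else head T a),
       head = (\<lambda>(a, fwd). if fwd then head T a else tail T a) \<rparr>"

definition quiver_tree :: "('v, 'a) pre_digraph \<Rightarrow> bool" where
  "quiver_tree T \<longleftrightarrow>
     fin_digraph T \<and> connected T \<and>
     \<not> (\<exists>p. pre_digraph.cycle (double_quiver T) p \<and> distinct (map fst p))"

definition rooted_tree :: "('v, 'a) pre_digraph \<Rightarrow> bool" where
  "rooted_tree T \<longleftrightarrow> quiver_tree T \<and>
     ((\<exists>!r. r \<in> verts T \<and> out_arcs T r = {}) \<or> (\<exists>!r. r \<in> verts T \<and> in_arcs T r = {}))"

text \<open>
  A quiver morphism is a pair of maps; it is determined by its values on the vertices and arrows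
  of its source, so equality of morphisms is equality there.
\<close>

definition quiver_morphism ::
    "('n, 'e) pre_digraph \<Rightarrow> ('v, 'a) pre_digraph \<Rightarrow> ('n \<Rightarrow> 'v) \<times> ('e \<Rightarrow> 'a) \<Rightarrow> bool" where
  "quiver_morphism T Q F \<longleftrightarrow>
     (\<forall>n\<in>verts T. fst F n \<in> verts Q) \<and>
     (\<forall>e\<in>arcs T. snd F e \<in> arcs Q \<and> tail Q (snd F e) = fst F (tail T e) \<and>
        head Q (snd F e) = fst F (head T e))"

definition morphism_eq ::
    "('n, 'e) pre_digraph \<Rightarrow> ('n \<Rightarrow> 'v) \<times> ('e \<Rightarrow> 'a) \<Rightarrow> ('n \<Rightarrow> 'v) \<times> ('e \<Rightarrow> 'a) \<Rightarrow> bool" where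
  "morphism_eq T F G \<longleftrightarrow> (\<forall>n\<in>verts T. fst F n = fst G n) \<and> (\<forall>e\<in>arcs T. snd F e = snd G e)"

definition morphism_comp ::
    "('m \<Rightarrow> 'v) \<times> ('d \<Rightarrow> 'a) \<Rightarrow> ('n \<Rightarrow> 'm) \<times> ('e \<Rightarrow> 'd) \<Rightarrow> ('n \<Rightarrow> 'v) \<times> ('e \<Rightarrow> 'a)" where
  "morphism_comp G F = (fst G \<circ> fst F, snd G \<circ> snd F)"

definition path_image ::
    "('n \<Rightarrow> 'v) \<times> ('e \<Rightarrow> 'a) \<Rightarrow> ('n, 'e) path \<Rightarrow> ('v, 'a) path" where
  "path_image F p = (fst F (fst p), map (snd F) (snd p))"

definition bound_morphism ::
    "'k::field itself \<Rightarrow> ('v, 'a) pre_digraph \<Rightarrow> ('v, 'a) path set \<Rightarrow> ('n, 'e) pre_digraph \<Rightarrow>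
      ('n \<Rightarrow> 'v) \<times> ('e \<Rightarrow> 'a) \<Rightarrow> bool" where
  "bound_morphism K Q \<rho> T F \<longleftrightarrow>
     quiver_morphism T Q F \<and> \<not> (\<exists>p\<in>paths T. zero_path K Q \<rho> (path_image F p))"

definition idempotent_morphism ::
    "('n, 'e) pre_digraph \<Rightarrow> ('n \<Rightarrow> 'n) \<times> ('e \<Rightarrow> 'e) \<Rightarrow> bool" where
  "idempotent_morphism T \<iota> \<longleftrightarrow>
     quiver_morphism T T \<iota> \<and> morphism_eq T (morphism_comp \<iota> \<iota>) \<iota>"


section \<open>The tree module\<close>

definition tree_module ::
    "('n, 'e) pre_digraph \<Rightarrow> ('n \<Rightarrow> 'v) \<times> ('e \<Rightarrow> 'a) \<Rightarrow>
      ('v, 'a, 'n \<Rightarrow>\<^sub>0 'k::field) quiver_rep" where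
  "tree_module T F =
     \<lparr> space_at = (\<lambda>x. module.span fscale (bvec ` {n \<in> verts T. fst F n = x})),
       act = (\<lambda>\<gamma> m. \<Sum>n\<in>Poly_Mapping.keys m. fscale (Poly_Mapping.lookup m n)
                 (\<Sum>e\<in>{e \<in> arcs T. tail T e = n \<and> snd F e = \<gamma>}. bvec (head T e))) \<rparr>"


text \<open>The tree module is a module over the zero-relation algebra.\<close>

lemma tree_module_space:
  "space_at (tree_module T F :: ('v, 'a, 'n \<Rightarrow>\<^sub>0 'k::field) quiver_rep) x =
     {m. Poly_Mapping.keys m \<subseteq> {n \<in> verts T. fst F n = x}}" (is "_ = {m. _ \<subseteq> ?B}")
proof -
  interpret vs: vector_space "fscale :: 'k \<Rightarrow> ('n \<Rightarrow>\<^sub>0 'k) \<Rightarrow> _" by (rule vector_space_fscale)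
  have sub: "vs.subspace {m :: 'n \<Rightarrow>\<^sub>0 'k. Poly_Mapping.keys m \<subseteq> ?B}"
  proof (rule vs.subspaceI)
    fix c :: 'k and y :: "'n \<Rightarrow>\<^sub>0 'k"
    have "Poly_Mapping.keys (fscale c y) \<subseteq> Poly_Mapping.keys y" by (auto simp: in_keys_iff)
    then show "y \<in> {m. Poly_Mapping.keys m \<subseteq> ?B} \<Longrightarrow> fscale c y \<in> {m. Poly_Mapping.keys m \<subseteq> ?B}"
      by blast
  next
    fix y z :: "'n \<Rightarrow>\<^sub>0 'k"
    show "y \<in> {m. Poly_Mapping.keys m \<subseteq> ?B} \<Longrightarrow> z \<in> {m. Poly_Mapping.keys m \<subseteq> ?B} \<Longrightarrow>
        y + z \<in> {m. Poly_Mapping.keys m \<subseteq> ?B}"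
      using keys_add[of y z] by blast
  qed simp
  have 1: "vs.span (bvec ` ?B) \<subseteq> {m. Poly_Mapping.keys m \<subseteq> ?B}"
    by (rule vs.span_minimal[OF _ sub]) (auto simp: bvec_def)
  have 2: "m \<in> vs.span (bvec ` ?B)" if m: "Poly_Mapping.keys m \<subseteq> ?B" for m :: "'n \<Rightarrow>\<^sub>0 'k"
  proof -
    have "m = (\<Sum>n\<in>Poly_Mapping.keys m. fscale (Poly_Mapping.lookup m n) (bvec n))"
      by (rule poly_mapping_eqI)
        (auto simp: lookup_sum bvec_def lookup_single when_def in_keys_iff if_distrib sum.delta cong: if_cong)
    moreover have "\<dots> \<in> vs.span (bvec ` ?B)"
      by (intro vs.span_sum vs.span_scale vs.span_base) (use m in auto)
    ultimately show ?thesis by simp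
  qed
  show ?thesis using 1 2 by (auto simp: tree_module_def)
qed

lemma tree_module_act_keys:
  assumes "k \<in> Poly_Mapping.keys (act (tree_module T F :: ('v, 'a, 'n \<Rightarrow>\<^sub>0 'k::field) quiver_rep) \<gamma> m)"
  obtains e where "e \<in> arcs T" "tail T e \<in> Poly_Mapping.keys m" "snd F e = \<gamma>" "head T e = k"
proof -
  from assms obtain n where n: "n \<in> Poly_Mapping.keys m"
    "Poly_Mapping.lookup (\<Sum>e\<in>{e \<in> arcs T. tail T e = n \<and> snd F e = \<gamma>}. bvec (head T e) :: 'n \<Rightarrow>\<^sub>0 'k) k \<noteq> 0"
    by (auto simp: tree_module_def in_keys_iff lookup_sum elim!: sum.not_neutral_contains_not_neutral)
  then obtain e where "e \<in> {e \<in> arcs T. tail T e = n \<and> snd F e = \<gamma>}"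
    "Poly_Mapping.lookup (bvec (head T e) :: 'n \<Rightarrow>\<^sub>0 'k) k \<noteq> 0"
    unfolding lookup_sum by (elim sum.not_neutral_contains_not_neutral)
  with n that show ?thesis by (auto simp: bvec_def lookup_single when_def split: if_splits)
qed

lemma tree_module_fold_keys:
  assumes "wf_digraph T"
    and "k \<in> Poly_Mapping.keys (fold (act (tree_module T F :: ('v, 'a, 'n \<Rightarrow>\<^sub>0 'k::field) quiver_rep)) as m)"
    and "Poly_Mapping.keys m \<subseteq> verts T"
  shows "\<exists>n es. n \<in> Poly_Mapping.keys m \<and> pre_digraph.awalk T n es k \<and> map (snd F) es = as"
  using assms(2,3)
proof (induction as arbitrary: m)
  case Nil
  then show ?case
    by (auto simp: pre_digraph.awalk_def pre_digraph.cas.simps intro!: exI[of _ k] exI[of _ "[]"])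
next
  interpret wf_digraph T by fact
  case (Cons \<gamma> as m)
  let ?m = "act (tree_module T F :: ('v, 'a, 'n \<Rightarrow>\<^sub>0 'k) quiver_rep) \<gamma> m"
  have "Poly_Mapping.keys ?m \<subseteq> verts T" by (auto elim!: tree_module_act_keys)
  moreover have "k \<in> Poly_Mapping.keys (fold (act (tree_module T F :: ('v, 'a, 'n \<Rightarrow>\<^sub>0 'k) quiver_rep)) as ?m)"
    using Cons.prems(1) by simp
  ultimately obtain n es where *: "n \<in> Poly_Mapping.keys ?m" "awalk n es k" "map (snd F) es = as"
    using Cons.IH[of ?m] by blast
  from *(1) obtain e where "e \<in> arcs T" "tail T e \<in> Poly_Mapping.keys m" "snd F e = \<gamma>" "head T e = n"
    by (rule tree_module_act_keys)
  with * have "tail T e \<in> Poly_Mapping.keys m \<and> awalk (tail T e) (e # es) k \<and> map (snd F) (e # es) = \<gamma> # as"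
    by (auto simp: awalk_Cons_iff)
  then show ?case by (intro exI)
qed

lemma tree_module_representation:
  fixes F :: "('n \<Rightarrow> 'v) \<times> ('e \<Rightarrow> 'a)"
  assumes "fin_digraph T" "bound_morphism TYPE('k::field) Q \<rho> T F"
  shows "representation fscale Q \<rho> (tree_module T F :: ('v, 'a, 'n \<Rightarrow>\<^sub>0 'k) quiver_rep)"
proof -
  interpret fin_digraph T by fact
  interpret vs: vector_space "fscale :: 'k \<Rightarrow> ('n \<Rightarrow>\<^sub>0 'k) \<Rightarrow> _" by (rule vector_space_fscale)
  let ?M = "tree_module T F :: ('v, 'a, 'n \<Rightarrow>\<^sub>0 'k) quiver_rep"
  have mor: "quiver_morphism T Q F" using assms(2) by (simp add: bound_morphism_def)
  have act: "act ?M \<gamma> m = (\<Sum>n\<in>verts T. fscale (Poly_Mapping.lookup m n)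
      (\<Sum>e\<in>{e \<in> arcs T. tail T e = n \<and> snd F e = \<gamma>}. bvec (head T e)))"
    if "m \<in> space_at ?M x" for m \<gamma> x
    using that unfolding tree_module_space
    by (auto simp: tree_module_def in_keys_iff intro!: sum.mono_neutral_left)
  have sub: "vs.subspace (space_at ?M x)" for x by (simp add: tree_module_def)
  have "act ?M \<gamma> m \<in> space_at ?M (head Q \<gamma>)" for \<gamma> m
    using mor unfolding tree_module_space quiver_morphism_def
    by (auto elim!: tree_module_act_keys)
  moreover have "act ?M \<gamma> (fscale c m) = fscale c (act ?M \<gamma> m)" if "m \<in> space_at ?M x" for c \<gamma> m x
    using that vs.subspace_scale[OF sub that, of c] by (simp add: act vs.scale_sum_right)
  moreover have "act ?M \<gamma> (m + m') = act ?M \<gamma> m + act ?M \<gamma> m'"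
    if "m \<in> space_at ?M x" "m' \<in> space_at ?M x" for \<gamma> m m' x
    using that vs.subspace_add[OF sub that]
    by (simp add: act lookup_add vs.scale_left_distrib sum.distrib)
  moreover have "fold (act ?M) (snd r) m = 0" if r: "r \<in> \<rho>" and m: "m \<in> space_at ?M (fst r)" for r m
  proof (rule ccontr)
    assume "fold (act ?M) (snd r) m \<noteq> 0"
    then obtain k where "k \<in> Poly_Mapping.keys (fold (act ?M) (snd r) m)"
      using keys_eq_empty by blast
    then obtain n es where n: "n \<in> Poly_Mapping.keys m" "awalk n es k" "map (snd F) es = snd r"
      using tree_module_fold_keys[OF wf_digraph] m unfolding tree_module_space by blast
    then have "path_image F (n, es) = r" "(n, es) \<in> paths T"
      using m unfolding tree_module_space path_image_def paths_def by (auto simp: prod_eq_iff)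
    moreover have "zero_path TYPE('k) Q \<rho> r"
      unfolding zero_path_def rel_ideal_def using r by (auto intro!: hull_inc)
    ultimately show False using assms(2) by (auto simp: bound_morphism_def)
  qed
  ultimately show ?thesis
    unfolding representation_def using sub vector_space_fscale by blast
qed

end

theory Submission
  imports Defs
begin

text \<open>
  Let \<open>T\<close> have a unique sink \<open>r\<close>, the case of a unique source being dual by reversing \<open>T\<close> and
  transposing matrices.  A retraction \<open>\<iota>\<close> over \<open>F\<close> induces the idempotent endomorphism
  \<open>v\<^sub>n \<mapsto> v\<^sub>\<iota>\<^sub>n\<close> of the tree module.  Conversely let \<open>c\<close> be the matrix of an idempotent
  endomorphism.  If \<open>c k n \<noteq> 0\<close>, then every child of \<open>n\<close> is sent by \<open>c\<close> to a combination involving a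
  child of \<open>k\<close> with the same label, so the branch at \<open>n\<close> maps to the branch at \<open>k\<close>.
  If one branch maps to a sibling branch with the same label, folding the former onto the latter is
  a non-identity retraction.  If this never happens, the diagonal of \<open>c\<close> is constant, equal to 0 or 1
  by idempotency at the root; and the relation \<open>c k n \<noteq> 0\<close> has no cycles between distinct vertices,
  because a cycle is carried to one between the parents and eventually to one through the root.
  So \<open>c\<close> or \<open>1 - c\<close> is nilpotent, hence zero.
\<close>

section \<open>Rooted trees\<close>

definition opposite :: "('n, 'e) pre_digraph \<Rightarrow> ('n, 'e) pre_digraph" where
  "opposite T = \<lparr> verts = verts T, arcs = arcs T, tail = head T, head = tail T \<rparr>"

lemma opposite_simps [simp]:
  "verts (opposite T) = verts T" "arcs (opposite T) = arcs T"
  "tail (opposite T) = head T" "head (opposite T) = tail T" "opposite (opposite T) = T"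
  by (simp_all add: opposite_def)

lemma fin_digraph_opposite: "fin_digraph T \<Longrightarrow> fin_digraph (opposite T)"
  unfolding fin_digraph_def fin_digraph_axioms_def wf_digraph_def by auto

text \<open>The undirected steps that remain when the single arrow \<open>a\<close> is deleted.
  Arrows parallel to \<open>a\<close> are kept, so reachability along these steps tests whether
  \<open>a\<close> is a bridge.\<close>

definition steps_avoiding :: "('n, 'e) pre_digraph \<Rightarrow> 'e \<Rightarrow> ('n \<times> 'n) set" where
  "steps_avoiding T a =
     (\<lambda>b. (tail T b, head T b)) ` (arcs T - {a}) \<union> (\<lambda>b. (head T b, tail T b)) ` (arcs T - {a})"

definition all_bridges :: "('n, 'e) pre_digraph \<Rightarrow> bool" where
  "all_bridges T \<longleftrightarrow> (\<forall>a\<in>arcs T. (head T a, tail T a) \<notin> (steps_avoiding T a)\<^sup>*)"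

lemma sym_steps_avoiding: "sym (steps_avoiding T a)"
  by (auto simp: steps_avoiding_def sym_def)

lemma all_bridges_opposite:
  assumes "all_bridges T"
  shows "all_bridges (opposite T)"
proof -
  have "steps_avoiding (opposite T) a = steps_avoiding T a" for a
    by (auto simp: steps_avoiding_def)
  then show ?thesis
    using assms sym_rtrancl[OF sym_steps_avoiding, of T] unfolding all_bridges_def sym_def by auto
qed

lemma double_quiver_simps [simp]:
  "verts (double_quiver T) = verts T" "arcs (double_quiver T) = arcs T \<times> UNIV"
  "tail (double_quiver T) (a, i) = (if i then tail T a else head T a)"
  "head (double_quiver T) (a, i) = (if i then head T a else tail T a)"
  by (simp_all add: double_quiver_def)

lemma wf_digraph_double_quiver:
  assumes "wf_digraph T"
  shows "wf_digraph (double_quiver T)"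
proof -
  interpret wf_digraph T by fact
  show ?thesis by unfold_locales (auto simp: double_quiver_def)
qed

text \<open>An arrow and its formal inverse have the same endpoints, so a path visiting no vertex twice
  cannot contain both.\<close>

lemma double_quiver_apath_arcs:
  assumes "wf_digraph T" "pre_digraph.apath (double_quiver T) u p v"
  shows "distinct (map fst p)"
proof -
  interpret D: wf_digraph "double_quiver T" by (rule wf_digraph_double_quiver) fact
  have ends: "tail (double_quiver T) y \<in> set (D.awalk_verts w q) \<and> head (double_quiver T) y \<in> set (D.awalk_verts w q)"
    if "D.awalk w q v" "y \<in> set q" for y w q
    using that
  proof (induction q arbitrary: w)
    case (Cons e q)
    then show ?case using D.hd_in_awalk_verts(1)[of "head (double_quiver T) e" q v]
      by (auto simp: D.awalk_Cons_iff)
  qed simp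
  show ?thesis
    using assms(2)
  proof (induction p arbitrary: u)
    case (Cons e p)
    then have p: "D.apath (head (double_quiver T) e) p v"
      "tail (double_quiver T) e \<notin> set (D.awalk_verts (head (double_quiver T) e) p)"
      by (auto simp: D.apath_Cons_iff)
    have "fst e \<noteq> fst y" if "y \<in> set p" for y
    proof
      assume "fst e = fst y"
      then have "tail (double_quiver T) e \<in> {tail (double_quiver T) y, head (double_quiver T) y}"
        by (auto simp: double_quiver_def split: prod.splits)
      with ends[of "head (double_quiver T) e" p y] p that show False
        by (auto simp: D.apath_def)
    qed
    with Cons.IH[OF p(1)] show ?case by auto
  qed simp
qed

text \<open>A walk around \<open>a\<close> shortens to a path without repeated vertices, and this
  path together with \<open>a\<close> is a cycle using no arrow twice. A loop is covered with the
  empty path.\<close>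

lemma quiver_tree_all_bridges:
  assumes "quiver_tree T"
  shows "all_bridges T"
  unfolding all_bridges_def
proof (intro ballI notI)
  fix a assume a: "a \<in> arcs T" and reach: "(head T a, tail T a) \<in> (steps_avoiding T a)\<^sup>*"
  interpret fin_digraph T using assms by (simp add: quiver_tree_def)
  interpret D: wf_digraph "double_quiver T" by (rule wf_digraph_double_quiver) (rule wf_digraph)
  from reach have "\<exists>p. D.awalk (head T a) p (tail T a) \<and> a \<notin> fst ` set p"
  proof (induction rule: converse_rtrancl_induct)
    case base
    then show ?case using a by (intro exI[of _ "[]"]) (simp add: D.awalk_Nil_iff)
  next
    case (step y z)
    then obtain p where p: "D.awalk z p (tail T a)" "a \<notin> fst ` set p" by blast
    from step(1) obtain b where "b \<in> arcs T - {a}"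
      "(y, z) = (tail T b, head T b) \<or> (y, z) = (head T b, tail T b)"
      unfolding steps_avoiding_def by blast
    then obtain i where i: "(b, i) \<in> arcs (double_quiver T)" "tail (double_quiver T) (b, i) = y"
      "head (double_quiver T) (b, i) = z" "b \<noteq> a"
      using that[of True] that[of False] by auto
    with p show ?case by (intro exI[of _ "(b, i) # p"]) (auto simp: D.awalk_Cons_iff)
  qed
  then obtain p where p: "D.awalk (head T a) p (tail T a)" "a \<notin> fst ` set p" by blast
  define q where "q = D.awalk_to_apath p"
  have q: "D.apath (head T a) q (tail T a)"
    unfolding q_def by (rule D.apath_awalk_to_apath) (rule p(1))
  have "set q \<subseteq> set p" unfolding q_def using p(1) by (rule D.awalk_to_apath_subset)
  with p(2) have "a \<notin> fst ` set q" by blast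
  then have "distinct (map fst ((a, True) # q))"
    using double_quiver_apath_arcs[OF wf_digraph q] by simp
  moreover have "D.cycle ((a, True) # q)"
    unfolding D.cycle_def using q a
    by (intro exI[of _ "tail T a"]) (simp add: D.apath_def D.awalk_Cons_iff)
  ultimately show False using assms unfolding quiver_tree_def by blast
qed

section \<open>In-trees obtained from trees with a unique sink\<close>

text \<open>Arrows point towards the root \<^term>\<open>r\<close>; the value \<^term>\<open>up r\<close> is irrelevant.\<close>

locale in_tree = fin_digraph T for T :: "('n, 'e) pre_digraph" +
  fixes r :: 'n and up :: "'n \<Rightarrow> 'e"
  assumes root: "r \<in> verts T"
    and up: "n \<in> verts T \<Longrightarrow> n \<noteq> r \<Longrightarrow> up n \<in> arcs T \<and> tail T (up n) = n"
    and arc: "a \<in> arcs T \<Longrightarrow> tail T a \<noteq> r \<and> up (tail T a) = a"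
    and acyclic_arcs: "acyclic ((\<lambda>a. (tail T a, head T a)) ` arcs T)"

text \<open>Cut the walk just before its first use of \<open>a\<close>: either there is no such use,
  or the initial part reaches the start of \<open>a\<close>.\<close>

lemma rtrancl_image_avoiding:
  assumes "(x, y) \<in> (h ` A)\<^sup>*"
  shows "(x, y) \<in> (h ` (A - {a}))\<^sup>* \<or> (x, fst (h a)) \<in> (h ` (A - {a}))\<^sup>*"
  using assms
proof (induction rule: rtrancl_induct)
  case (step y z)
  then obtain b where b: "b \<in> A" "h b = (y, z)" by (metis imageE)
  show ?case
  proof (cases "b = a")
    case True
    then show ?thesis using step.IH b by auto
  next
    case False
    then have "(y, z) \<in> h ` (A - {a})" using b by (metis DiffI image_eqI singletonD)
    then show ?thesis using step.IH by (meson rtrancl.rtrancl_into_rtrancl)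
  qed
qed simp

text \<open>Following arrows in a finite acyclic quiver ends in a sink, hence in \<open>r\<close>.
  Two arrows leaving one vertex would give a detour around the first of them through
  \<open>r\<close>, so the arrow to the parent is unique.\<close>

lemma all_bridges_unique_sink_in_tree:
  assumes "fin_digraph T" "all_bridges T" "\<exists>!r. r \<in> verts T \<and> out_arcs T r = {}"
  shows "\<exists>r up. in_tree T r up"
proof -
  interpret fin_digraph T by fact
  let ?h = "\<lambda>a. (tail T a, head T a)"
  define E where "E = ?h ` arcs T"
  have avoid: "(?h ` (arcs T - {a}))\<^sup>* \<subseteq> (steps_avoiding T a)\<^sup>*" for a
    by (rule rtrancl_mono) (auto simp: steps_avoiding_def)
  have no_cycle: "(head T a, tail T a) \<notin> E\<^sup>*" if "a \<in> arcs T" for a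
    using rtrancl_image_avoiding[of "head T a" "tail T a" ?h "arcs T" a] avoid[of a] that assms(2)
    unfolding E_def all_bridges_def by auto
  have acyc: "acyclic E"
  proof (rule acyclicI, intro allI notI)
    fix x assume "(x, x) \<in> E\<^sup>+"
    then obtain y where "(x, y) \<in> E" "(y, x) \<in> E\<^sup>*" by (meson tranclD)
    then show False using no_cycle unfolding E_def by auto
  qed
  have "finite E" by (simp add: E_def)
  then have wf: "wf (E\<inverse>)" using acyc by (simp add: finite_acyclic_wf_converse)
  from assms(3) obtain r where r: "r \<in> verts T" "out_arcs T r = {}"
    and uniq: "\<And>n. n \<in> verts T \<Longrightarrow> out_arcs T n = {} \<Longrightarrow> n = r" by blast
  have reach: "(n, r) \<in> E\<^sup>*" if "n \<in> verts T" for n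
    using wf that
  proof (induction n rule: wf_induct_rule)
    case (less n)
    show ?case
    proof (cases "n = r")
      case False
      then obtain a where a: "a \<in> arcs T" "tail T a = n" using uniq less.prems by (auto simp: out_arcs_def)
      then have "(n, head T a) \<in> E" by (auto simp: E_def)
      with less.IH[of "head T a"] a show ?thesis by (auto intro: converse_rtrancl_into_rtrancl)
    qed simp
  qed
  have unique_out: "a = b" if ab: "a \<in> arcs T" "b \<in> arcs T" "tail T a = tail T b" for a b
  proof (rule ccontr)
    assume "a \<noteq> b"
    \<comment> \<open>The directed walk from \<open>head T c\<close> to \<open>r\<close> cannot use
      \<open>a\<close>: it would return to the tail of \<open>c\<close> and close a directed
      cycle.\<close>
    have *: "(head T c, r) \<in> (steps_avoiding T a)\<^sup>*" if "c \<in> arcs T" "tail T c = tail T a" for c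
      using rtrancl_image_avoiding[of "head T c" r ?h "arcs T" a] reach[of "head T c"] that
        avoid[of a] rtrancl_mono[of "?h ` (arcs T - {a})" E] no_cycle[of c]
      unfolding E_def by auto
    \<comment> \<open>The detour runs from \<open>head T a\<close> to the root, from there to
      \<open>head T b\<close>, and backwards along \<open>b\<close> to the common tail.\<close>
    have "(r, head T b) \<in> (steps_avoiding T a)\<^sup>*"
      using *[of b] ab sym_rtrancl[OF sym_steps_avoiding, of T a] by (auto simp: sym_def)
    moreover have "(head T b, tail T a) \<in> steps_avoiding T a"
      using ab \<open>a \<noteq> b\<close> by (auto simp: steps_avoiding_def)
    ultimately have "(head T a, tail T a) \<in> (steps_avoiding T a)\<^sup>*"
      using *[of a] ab by (meson rtrancl.rtrancl_into_rtrancl rtrancl_trans)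
    then show False using assms(2) ab unfolding all_bridges_def by blast
  qed
  define up where "up n = (SOME a. a \<in> arcs T \<and> tail T a = n)" for n
  have up: "up n \<in> arcs T \<and> tail T (up n) = n" if "n \<in> verts T" "n \<noteq> r" for n
    unfolding up_def by (rule someI_ex) (use uniq[of n] that in \<open>auto simp: out_arcs_def\<close>)
  have tail: "tail T a \<noteq> r" if "a \<in> arcs T" for a using r(2) that by (auto simp: out_arcs_def)
  have "in_tree T r up"
  proof
    show "tail T a \<noteq> r \<and> up (tail T a) = a" if "a \<in> arcs T" for a
      using tail[OF that] up[of "tail T a"] that unique_out[of "up (tail T a)" a] by simp
  qed (use r up acyc in \<open>auto simp: E_def\<close>)
  then show ?thesis by blast
qed


section \<open>Retractions of in-trees and idempotent matrices\<close>

definition retraction :: "('n, 'e) pre_digraph \<Rightarrow> ('n \<Rightarrow> 'v) \<times> ('e \<Rightarrow> 'a) \<Rightarrow> ('n \<Rightarrow> 'n) \<times> ('e \<Rightarrow> 'e) \<Rightarrow> bool" where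
  "retraction T F \<iota> \<longleftrightarrow> idempotent_morphism T \<iota> \<and> morphism_eq T (morphism_comp F \<iota>) F"

lemma retraction_iff:
  "retraction T F (f, g) \<longleftrightarrow>
     (\<forall>n\<in>verts T. f n \<in> verts T \<and> f (f n) = f n \<and> fst F (f n) = fst F n) \<and>
     (\<forall>a\<in>arcs T. g a \<in> arcs T \<and> tail T (g a) = f (tail T a) \<and> head T (g a) = f (head T a) \<and>
        g (g a) = g a \<and> snd F (g a) = snd F a)"
  unfolding retraction_def idempotent_morphism_def quiver_morphism_def morphism_eq_def morphism_comp_def
  by auto

text \<open>The matrix \<^term>\<open>c\<close> sends \<open>v\<^sub>n\<close> to \<open>\<Sum>k. c k n v\<^sub>k\<close>; comparing the coefficients of
  \<open>v\<^sub>k\<close> shows that the second condition says that it commutes with the arrow \<open>\<gamma>\<close>.  All three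
  conditions are preserved when \<^term>\<open>T\<close> is reversed and \<^term>\<open>c\<close> is transposed.\<close>

definition idempotent_matrix ::
    "('n, 'e) pre_digraph \<Rightarrow> ('n \<Rightarrow> 'v) \<times> ('e \<Rightarrow> 'a) \<Rightarrow> ('n \<Rightarrow> 'n \<Rightarrow> 'k::field) \<Rightarrow> bool" where
  "idempotent_matrix T F c \<longleftrightarrow>
     (\<forall>k\<in>verts T. \<forall>n\<in>verts T. c k n \<noteq> 0 \<longrightarrow> fst F k = fst F n) \<and>
     (\<forall>\<gamma>. \<forall>k\<in>verts T. \<forall>n\<in>verts T.
        (\<Sum>a | a \<in> arcs T \<and> head T a = k \<and> snd F a = \<gamma>. c (tail T a) n) =
        (\<Sum>a | a \<in> arcs T \<and> tail T a = n \<and> snd F a = \<gamma>. c k (head T a))) \<and>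
     (\<forall>k\<in>verts T. \<forall>n\<in>verts T. (\<Sum>m\<in>verts T. c k m * c m n) = c k n)"

definition trivial_matrix :: "('n, 'e) pre_digraph \<Rightarrow> ('n \<Rightarrow> 'n \<Rightarrow> 'k::field) \<Rightarrow> bool" where
  "trivial_matrix T c \<longleftrightarrow> (\<forall>k\<in>verts T. \<forall>n\<in>verts T. c k n = 0) \<or>
     (\<forall>k\<in>verts T. \<forall>n\<in>verts T. c k n = of_bool (k = n))"

lemma idempotent_matrix_opposite:
  "idempotent_matrix T F c \<Longrightarrow> idempotent_matrix (opposite T) F (\<lambda>k n. c n k)"
  unfolding idempotent_matrix_def by (simp add: mult.commute)

lemma trivial_matrix_opposite:
  assumes "trivial_matrix T c"
  shows "trivial_matrix (opposite T) (\<lambda>k n. c n k)"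
  using assms unfolding trivial_matrix_def opposite_simps
proof (elim disjE)
  assume c: "\<forall>k\<in>verts T. \<forall>n\<in>verts T. c k n = of_bool (k = n)"
  have "c n k = of_bool (k = n)" if "k \<in> verts T" "n \<in> verts T" for k n
    using c[rule_format, of n k] that by auto
  then show "(\<forall>k\<in>verts T. \<forall>n\<in>verts T. c n k = 0) \<or>
      (\<forall>k\<in>verts T. \<forall>n\<in>verts T. c n k = of_bool (k = n))" by blast
qed blast

lemma nontrivial_idempotent_matrix_opposite:
  fixes T :: "('n, 'e) pre_digraph"
  shows "(\<exists>c :: 'n \<Rightarrow> 'n \<Rightarrow> 'k::field. idempotent_matrix (opposite T) F c \<and> \<not> trivial_matrix (opposite T) c) \<longleftrightarrow>
   (\<exists>c :: 'n \<Rightarrow> 'n \<Rightarrow> 'k::field. idempotent_matrix T F c \<and> \<not> trivial_matrix T c)"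
proof -
  have *: "\<exists>c :: 'n \<Rightarrow> 'n \<Rightarrow> 'k. idempotent_matrix (opposite U) F c \<and> \<not> trivial_matrix (opposite U) c"
    if c: "idempotent_matrix U F c" "\<not> trivial_matrix U c"
    for U :: "('n, 'e) pre_digraph" and c :: "'n \<Rightarrow> 'n \<Rightarrow> 'k"
  proof (intro exI conjI)
    show "idempotent_matrix (opposite U) F (\<lambda>k n. c n k)"
      by (rule idempotent_matrix_opposite) (rule c)
    show "\<not> trivial_matrix (opposite U) (\<lambda>k n. c n k)"
      using trivial_matrix_opposite[of "opposite U" "\<lambda>k n. c n k"] c(2) by auto
  qed
  from *[of T] *[of "opposite T"] show ?thesis by auto
qed

lemma retraction_opposite: "retraction (opposite T) F \<iota> \<longleftrightarrow> retraction T F \<iota>"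
  by (cases \<iota>) (auto simp: retraction_iff)

text \<open>Passing from a projection to \<open>1 - c\<close> exchanges image and kernel; this
  reduces the case of root entry \<open>1\<close> to that of root entry \<open>0\<close>.\<close>

lemma idempotent_matrix_complement:
  fixes c :: "'n \<Rightarrow> 'n \<Rightarrow> 'k::field"
  assumes "fin_digraph T" "idempotent_matrix T F c"
  shows "idempotent_matrix T F (\<lambda>k n. of_bool (k = n) - c k n)"
proof -
  interpret fin_digraph T by fact
  have comm: "(\<Sum>a | a \<in> arcs T \<and> head T a = k \<and> snd F a = \<gamma>. of_bool (tail T a = n) :: 'k) =
      (\<Sum>a | a \<in> arcs T \<and> tail T a = n \<and> snd F a = \<gamma>. of_bool (k = head T a))" for k n \<gamma>
  proof -
    have "(\<Sum>a | a \<in> arcs T \<and> head T a = k \<and> snd F a = \<gamma>. of_bool (tail T a = n) :: 'k) =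
        (\<Sum>a\<in>arcs T. of_bool (head T a = k \<and> tail T a = n \<and> snd F a = \<gamma>))"
      by (rule sum.mono_neutral_cong_left) auto
    also have "\<dots> = (\<Sum>a | a \<in> arcs T \<and> tail T a = n \<and> snd F a = \<gamma>. of_bool (k = head T a))"
      by (rule sum.mono_neutral_cong_right) auto
    finally show ?thesis .
  qed
  have idem: "(\<Sum>m\<in>verts T. (of_bool (k = m) - c k m) * (of_bool (m = n) - c m n)) = of_bool (k = n) - c k n"
    if kn: "k \<in> verts T" "n \<in> verts T" for k n
  proof -
    have "(\<Sum>m\<in>verts T. (of_bool (k = m) - c k m) * (of_bool (m = n) - c m n)) =
       (\<Sum>m\<in>verts T. of_bool (k = m) * (of_bool (m = n) - c m n)) -
       ((\<Sum>m\<in>verts T. c k m * of_bool (m = n)) - (\<Sum>m\<in>verts T. c k m * c m n))"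
      unfolding sum_subtractf[symmetric] by (rule sum.cong) (simp_all add: algebra_simps)
    also have "(\<Sum>m\<in>verts T. of_bool (k = m) * (of_bool (m = n) - c m n)) =
        (\<Sum>m\<in>{k}. of_bool (m = n) - c m n)"
      by (rule sum.mono_neutral_cong_right) (use kn in auto)
    also have "(\<Sum>m\<in>verts T. c k m * of_bool (m = n)) = (\<Sum>m\<in>{n}. c k m)"
      by (rule sum.mono_neutral_cong_right) (use kn in auto)
    also have "(\<Sum>m\<in>verts T. c k m * c m n) = c k n"
      using assms(2) kn by (simp add: idempotent_matrix_def)
    finally show ?thesis by simp
  qed
  show ?thesis
    using assms(2) idem unfolding idempotent_matrix_def by (auto simp: sum_subtractf comm split: if_splits)
qed

section \<open>The order of descendants in an in-tree\<close>

context in_tree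
begin

text \<open>Pairs run from child to parent, so \<open>(x, y) \<in> child_rel\<^sup>*\<close> says
  that \<open>x\<close> lies in the branch at \<open>y\<close>.\<close>

definition child_rel :: "('n \<times> 'n) set" where
  "child_rel = (\<lambda>a. (tail T a, head T a)) ` arcs T"

lemma child_relI: "a \<in> arcs T \<Longrightarrow> (tail T a, head T a) \<in> child_rel"
  by (simp add: child_rel_def)

lemma child_relE:
  assumes "(x, y) \<in> child_rel"
  obtains a where "a \<in> arcs T" "x = tail T a" "y = head T a"
  using assms by (auto simp: child_rel_def)

text \<open>The first form gives induction from the leaves to the root, the second from the root to
  the leaves.\<close>

lemma wf_child_rel: "wf child_rel" "wf (child_rel\<inverse>)"
  using acyclic_arcs unfolding child_rel_def
  by (auto intro: finite_acyclic_wf finite_acyclic_wf_converse)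

lemma not_below_child: "a \<in> arcs T \<Longrightarrow> (head T a, tail T a) \<notin> child_rel\<^sup>*"
  using acyclic_arcs child_relI rtrancl_into_trancl2[of "tail T a" "head T a"]
  unfolding acyclic_def child_rel_def[symmetric] by blast

lemma arc_eqI: "a \<in> arcs T \<Longrightarrow> b \<in> arcs T \<Longrightarrow> tail T a = tail T b \<Longrightarrow> a = b"
  using arc by metis

lemma single_valued_child_rel: "single_valued child_rel"
  by (rule single_valuedI) (use arc_eqI in \<open>auto simp: child_rel_def\<close>)

lemma below_cases:
  assumes "(x, y) \<in> child_rel\<^sup>*" "x \<noteq> y"
  shows "x \<in> verts T" "x \<noteq> r" "(head T (up x), y) \<in> child_rel\<^sup>*"
proof -
  from assms obtain z where z: "(x, z) \<in> child_rel" "(z, y) \<in> child_rel\<^sup>*"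
    by (meson converse_rtranclE)
  then obtain a where "a \<in> arcs T" "tail T a = x" "head T a = z" by (auto elim: child_relE)
  with z arc[of a] show "x \<in> verts T" "x \<noteq> r" "(head T (up x), y) \<in> child_rel\<^sup>*" by auto
qed

lemma parent_induct [consumes 1, case_names root child]:
  assumes "n \<in> verts T" "P r" "\<And>a. a \<in> arcs T \<Longrightarrow> P (head T a) \<Longrightarrow> P (tail T a)"
  shows "P n"
  using wf_child_rel(2) assms(1)
proof (induction n rule: wf_induct_rule)
  case (less n)
  show ?case
  proof (cases "n = r")
    case False
    then have "up n \<in> arcs T" "tail T (up n) = n" using up less.prems by auto
    then have "(n, head T (up n)) \<in> child_rel" using child_relI[of "up n"] by simp
    then have "P (head T (up n))" using less.IH \<open>up n \<in> arcs T\<close> by simp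
    then show ?thesis using assms(3)[of "up n"] \<open>up n \<in> arcs T\<close> \<open>tail T (up n) = n\<close> by simp
  qed (use assms in simp)
qed

text \<open>Morphisms preserve the order, so every image lies below \<open>f r\<close>. If
  \<open>f r\<close> were not the root, the only arrow leaving this fixed vertex would be fixed,
  hence its head too, which would then lie both above and below \<open>f r\<close>.\<close>

lemma retraction_root:
  assumes "retraction T F (f, g)"
  shows "f r = r"
proof (rule ccontr)
  assume "f r \<noteq> r"
  have f: "f (f r) = f r" "f r \<in> verts T" using assms root by (auto simp: retraction_iff)
  have "(f n, f r) \<in> child_rel\<^sup>*" if "n \<in> verts T" for n
    using that
  proof (induction rule: parent_induct)
    case (child a)
    have "(f (tail T a), f (head T a)) \<in> child_rel"
      using assms child(1) child_relI[of "g a"] by (auto simp: retraction_iff)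
    then show ?case using child(2) by (rule converse_rtrancl_into_rtrancl)
  qed simp
  note mono = this
  define a where "a = up (f r)"
  have a: "a \<in> arcs T" "tail T a = f r" using up f \<open>f r \<noteq> r\<close> by (auto simp: a_def)
  have "g a = a" using a assms f by (intro arc_eqI) (auto simp: retraction_iff)
  then have "f (head T a) = head T a" using assms a by (metis retraction_iff)
  with mono[of "head T a"] a not_below_child[of a] show False by auto
qed

text \<open>The endomorphism moves basis vectors along \<open>f\<close>. Away from the root exactly
  one arrow leaves \<open>n\<close>, and its image under \<open>g\<close> is the only one leaving
  \<open>f n\<close>, so each side of the commutation condition has at most one nonzero
  term.\<close>

lemma retraction_idempotent_matrix:
  assumes "retraction T F (f, g)"
  shows "idempotent_matrix T F (\<lambda>k n. of_bool (k = f n) :: 'k::field)"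
proof -
  note R = assms[unfolded retraction_iff]
  have comm: "(\<Sum>a | a \<in> arcs T \<and> head T a = k \<and> snd F a = \<gamma>. of_bool (tail T a = f n) :: 'k) =
       (\<Sum>a | a \<in> arcs T \<and> tail T a = n \<and> snd F a = \<gamma>. of_bool (k = f (head T a)))"
    if kn: "k \<in> verts T" "n \<in> verts T" for k n \<gamma>
  proof (cases "n = r")
    case True
    \<comment> \<open>As \<open>f\<close> fixes the sink, no arrow leaves \<open>f n\<close>
      either.\<close>
    then have "f n = r" using retraction_root assms by simp
    have "(\<Sum>a | a \<in> arcs T \<and> head T a = k \<and> snd F a = \<gamma>. of_bool (tail T a = f n) :: 'k) = 0"
      by (rule sum.neutral) (use arc \<open>f n = r\<close> in auto)
    moreover have "(\<Sum>a | a \<in> arcs T \<and> tail T a = n \<and> snd F a = \<gamma>. of_bool (k = f (head T a)) :: 'k) = 0"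
      by (rule sum.neutral) (use arc True in auto)
    ultimately show ?thesis by simp
  next
    case False
    define a where "a = up n"
    have a: "a \<in> arcs T" "tail T a = n" using up[OF kn(2) False] by (auto simp: a_def)
    have ga: "g a \<in> arcs T" "tail T (g a) = f n" "head T (g a) = f (head T a)" "snd F (g a) = snd F a"
      using R a by auto
    have "(\<Sum>a | a \<in> arcs T \<and> head T a = k \<and> snd F a = \<gamma>. of_bool (tail T a = f n) :: 'k) =
        (\<Sum>b\<in>{g a}. of_bool (head T b = k \<and> snd F b = \<gamma>))"
      by (rule sum.mono_neutral_cong) (use ga arc_eqI in auto)
    also have "\<dots> = (\<Sum>b\<in>{a}. of_bool (snd F b = \<gamma> \<and> k = f (head T b)))" using ga by auto
    also have "\<dots> = (\<Sum>a | a \<in> arcs T \<and> tail T a = n \<and> snd F a = \<gamma>. of_bool (k = f (head T a)))"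
      by (rule sum.mono_neutral_cong) (use a arc_eqI in auto)
    finally show ?thesis .
  qed
  have idem: "(\<Sum>m\<in>verts T. of_bool (k = f m) * of_bool (m = f n)) = (of_bool (k = f n) :: 'k)"
    if "n \<in> verts T" for k n
  proof -
    have "(\<Sum>m\<in>verts T. of_bool (k = f m) * of_bool (m = f n)) = (\<Sum>m\<in>{f n}. of_bool (k = f m) :: 'k)"
      by (rule sum.mono_neutral_cong_right) (use R that in auto)
    then show ?thesis using R that by simp
  qed
  show ?thesis using R comm idem by (auto simp: idempotent_matrix_def)
qed

text \<open>Every column contains a one, which rules out the zero matrix. For the identity matrix
  \<open>f\<close> fixes all vertices, and then \<open>g\<close> fixes all arrows because an arrow
  is determined by its tail.\<close>

lemma retraction_trivial_matrix:
  assumes "retraction T F (f, g)" "trivial_matrix T (\<lambda>k n. of_bool (k = f n) :: 'k::field)"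
  shows "morphism_eq T (f, g) (id, id)"
proof -
  note R = assms(1)[unfolded retraction_iff]
  have "\<not> (\<forall>k\<in>verts T. \<forall>n\<in>verts T. of_bool (k = f n) = (0 :: 'k))"
    using root R by auto
  then have "\<forall>k\<in>verts T. \<forall>n\<in>verts T. of_bool (k = f n) = (of_bool (k = n) :: 'k)"
    using assms(2) unfolding trivial_matrix_def by blast
  then have "of_bool (n = f n) = (of_bool (n = n) :: 'k)" if "n \<in> verts T" for n
    using that by blast
  then have f: "f n = n" if "n \<in> verts T" for n
    using that by (fastforce split: if_splits)
  moreover have "g a = a" if "a \<in> arcs T" for a
  proof (rule arc_eqI)
    have "tail T (g a) = f (tail T a)" using R that by blast
    then show "tail T (g a) = tail T a" using f that by simp
  qed (use R that in blast)+
  ultimately show ?thesis by (simp add: morphism_eq_def)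
qed

section \<open>Simulations between branches and the folding of siblings\<close>

text \<open>A pair \<open>(n, k)\<close> in a simulation extends to a homomorphism from the branch at \<open>n\<close> to the
  branch at \<open>k\<close>.\<close>

definition simulation :: "('n \<Rightarrow> 'v) \<times> ('e \<Rightarrow> 'a) \<Rightarrow> ('n \<times> 'n) set \<Rightarrow> bool" where
  "simulation F S \<longleftrightarrow> (\<forall>(n, k)\<in>S. fst F n = fst F k \<and>
     (\<forall>a\<in>arcs T. head T a = n \<longrightarrow>
        (\<exists>b\<in>arcs T. head T b = k \<and> snd F b = snd F a \<and> (tail T a, tail T b) \<in> S)))"

lemma simulation_step:
  assumes "simulation F S" "(head T a, k) \<in> S" "a \<in> arcs T"
  shows "\<exists>b\<in>arcs T. head T b = k \<and> snd F b = snd F a \<and> (tail T a, tail T b) \<in> S"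
  using assms unfolding simulation_def by blast

text \<open>Simulations compose; the closure serves for chains of nonzero matrix entries.\<close>

lemma simulation_rtrancl:
  assumes "simulation F S"
  shows "simulation F (S\<^sup>*)"
proof -
  have "fst F n = fst F k \<and> (\<forall>a\<in>arcs T. head T a = n \<longrightarrow>
        (\<exists>b\<in>arcs T. head T b = k \<and> snd F b = snd F a \<and> (tail T a, tail T b) \<in> S\<^sup>*))"
    if "(n, k) \<in> S\<^sup>*" for n k
    using that
  proof (induction rule: rtrancl_induct)
    case (step y z)
    have "\<exists>b\<in>arcs T. head T b = z \<and> snd F b = snd F a \<and> (tail T a, tail T b) \<in> S\<^sup>*"
      if a: "a \<in> arcs T" "head T a = n" for a
    proof -
      obtain b where b: "b \<in> arcs T" "head T b = y" "snd F b = snd F a" "(tail T a, tail T b) \<in> S\<^sup>*"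
        using step.IH a by blast
      then obtain d where "d \<in> arcs T" "head T d = z" "snd F d = snd F b" "(tail T b, tail T d) \<in> S"
        using simulation_step[OF assms, of b z] step.hyps by blast
      then show ?thesis using b by (metis rtrancl.rtrancl_into_rtrancl)
    qed
    moreover have "fst F y = fst F z" using assms step.hyps unfolding simulation_def by blast
    ultimately show ?case using step.IH by simp
  qed auto
  then show ?thesis unfolding simulation_def by blast
qed

lemma simulation_below:
  assumes "simulation F S" "(x, n) \<in> child_rel\<^sup>+" "(n, m) \<in> S"
  shows "\<exists>y. (y, m) \<in> child_rel\<^sup>+ \<and> (x, y) \<in> S"
  using assms(2)
proof (induction rule: converse_trancl_induct)
  case (base x)
  then obtain a where "a \<in> arcs T" "x = tail T a" "n = head T a" by (rule child_relE)
  with simulation_step[OF assms(1), of a m] assms(3) show ?case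
    using child_relI by blast
next
  case (step x z)
  then obtain y where y: "(y, m) \<in> child_rel\<^sup>+" "(z, y) \<in> S" by blast
  from step(1) obtain a where "a \<in> arcs T" "x = tail T a" "z = head T a" by (rule child_relE)
  with simulation_step[OF assms(1), of a y] y(2)
  obtain b where "b \<in> arcs T" "head T b = y" "(x, tail T b) \<in> S" by blast
  then show ?case using y(1) child_relI[of b] trancl_into_trancl2[of "tail T b" y] by blast
qed

text \<open>Were \<open>k\<close> strictly below \<open>n\<close>, copying the path from
  \<open>k\<close> up to \<open>n\<close> would give some \<open>y\<close> strictly below
  \<open>k\<close> with \<open>(k, y) \<in> S\<close>, and so on without end in a finite
  tree.\<close>

lemma simulation_not_below:
  assumes "simulation F S" "(n, k) \<in> S"
  shows "(k, n) \<notin> child_rel\<^sup>+"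
proof -
  have "\<forall>k. (n, k) \<in> S \<longrightarrow> (k, n) \<notin> child_rel\<^sup>+" for n
    using wf_trancl[OF wf_child_rel(1)]
  proof (induction n rule: wf_induct_rule)
    case (less n)
    then show ?case using simulation_below[OF assms(1)] by blast
  qed
  then show ?thesis using assms(2) by blast
qed

lemma simulation_root:
  assumes "simulation F S" "(r, k) \<in> S" "k \<in> verts T"
  shows "k = r"
proof -
  have "(n, r) \<in> child_rel\<^sup>*" if "n \<in> verts T" for n
    using that
  proof (induction rule: parent_induct)
    case (child a)
    then show ?case using child_relI[of a] by (auto intro: converse_rtrancl_into_rtrancl)
  qed simp
  then have "k = r \<or> (k, r) \<in> child_rel\<^sup>+" using assms(3) by (metis rtranclD)
  then show ?thesis using simulation_not_below assms by blast
qed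

text \<open>The retraction folds the branch at \<^term>\<open>tail T a\<close> onto a part of the branch at
  \<^term>\<open>tail T b\<close>.\<close>

lemma simulation_siblings_retraction:
  assumes S: "simulation F S" "(tail T a, tail T b) \<in> S"
    and ab: "a \<in> arcs T" "b \<in> arcs T" "a \<noteq> b" "head T a = head T b" "snd F a = snd F b"
  shows "\<exists>\<iota>. retraction T F \<iota> \<and> \<not> morphism_eq T \<iota> (id, id)"
proof -
  \<comment> \<open>\<open>D c\<close> is the branch hanging from the arrow
    \<open>c\<close>.\<close>
  define D where "D c = {x. (x, tail T c) \<in> child_rel\<^sup>*}" for c
  have D_up: "x \<in> verts T \<and> x \<noteq> r \<and> head T (up x) \<in> D c" if "x \<in> D c" "x \<noteq> tail T c" for x c
    using below_cases that unfolding D_def by blast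
  have D_down: "tail T e \<in> D c" if "e \<in> arcs T" "head T e \<in> D c" for e c
    using that unfolding D_def by (auto intro: converse_rtrancl_into_rtrancl child_relI)
  have head_D: "head T a \<notin> D c" if "c \<in> {a, b}" for c
    using that not_below_child[of c] ab by (auto simp: D_def)
  have sib: "tail T d \<notin> D c" if "c \<in> {a, b}" "d \<in> {a, b}" "c \<noteq> d" for c d
  proof
    assume "tail T d \<in> D c"
    moreover have "tail T d \<noteq> tail T c" using that ab arc_eqI by blast
    ultimately have "head T (up (tail T d)) \<in> D c" using D_up by blast
    then show False using head_D[of c] that arc[of d] ab by auto
  qed
  \<comment> \<open>The vertices above a given one form a chain, so a common vertex would make the
    two siblings comparable.\<close>
  have disj: "x \<notin> D b" if "x \<in> D a" for x
  proof
    assume "x \<in> D b"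
    then have "(tail T a, tail T b) \<in> child_rel\<^sup>* \<or> (tail T b, tail T a) \<in> child_rel\<^sup>*"
      using that single_valued_confluent[OF single_valued_child_rel] unfolding D_def by blast
    then show False using sib[of b a] sib[of a b] ab by (auto simp: D_def)
  qed
  \<comment> \<open>\<open>P f x y\<close> says that \<open>y\<close> is an admissible value at
    \<open>x\<close>, given \<open>f\<close> at the parent. The conditions
    \<open>(x, y) \<in> S\<close> and \<open>y \<in> D b\<close> are the invariants that provide a
    matching arrow at the next level down.\<close>
  define P where "P f x y \<longleftrightarrow>
    (if x \<notin> D a then y = x else (x, y) \<in> S \<and> y \<in> D b \<and>
      (if x = tail T a then y = tail T b else
        (\<exists>d\<in>arcs T. tail T d = y \<and> head T d = f (head T (up x)) \<and> snd F d = snd F (up x))))"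
    for f :: "'n \<Rightarrow> 'n" and x y
  \<comment> \<open>The choice descends from the root, since \<open>P f x\<close> depends on
    \<open>f\<close> only at the parent of \<open>x\<close>.\<close>
  have "\<exists>f. \<forall>x. P f x (f x)"
  proof (rule dependent_wf_choice[OF wf_child_rel(2)])
    have up_rel: "(head T (up x), x) \<in> child_rel\<inverse>" if "x \<in> D a" "x \<noteq> tail T a" for x
      using D_up[OF that] up[of x] child_relI[of "up x"] by auto
    show "P f x y = P g x y" if "\<And>z. (z, x) \<in> child_rel\<inverse> \<Longrightarrow> f z = g z" for f g x y
      using that[OF up_rel] unfolding P_def by auto
    show "\<exists>y. P f x y" if IH: "\<And>y. (y, x) \<in> child_rel\<inverse> \<Longrightarrow> P f y (f y)" for x f
    proof (cases "x \<in> D a \<and> x \<noteq> tail T a")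
      case True
      let ?q = "head T (up x)"
      have q: "up x \<in> arcs T" "tail T (up x) = x" "?q \<in> D a" using D_up[of x a] up True by auto
      have "P f ?q (f ?q)" using IH up_rel True by blast
      then have fq: "(?q, f ?q) \<in> S" "f ?q \<in> D b" using q(3) by (auto simp: P_def)
      with simulation_step[OF S(1), of "up x" "f ?q"] q
      obtain d where d: "d \<in> arcs T" "head T d = f ?q" "snd F d = snd F (up x)" "(x, tail T d) \<in> S"
        by auto
      then have "P f x (tail T d)" using True D_down[of d b] fq(2) unfolding P_def by auto
      then show ?thesis by blast
    next
      case False
      then have "P f x (if x \<in> D a then tail T b else x)" using S(2) by (auto simp: P_def D_def)
      then show ?thesis by blast
    qed
  qed
  then obtain f where f: "P f x (f x)" for x by blast
  have f_out: "f x = x" if "x \<notin> D a" for x using f[of x] that by (simp add: P_def)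
  have f_in: "(x, f x) \<in> S" "f x \<in> D b" if "x \<in> D a" for x using f[of x] that by (auto simp: P_def)
  have f_tail: "f (tail T a) = tail T b" using f[of "tail T a"] by (auto simp: P_def D_def)
  \<comment> \<open>All values avoid the folded branch, outside which \<open>f\<close> is the
    identity; this makes \<open>f\<close> idempotent.\<close>
  have f_notin: "f x \<notin> D a" for x using f_in(2)[of x] f_out[of x] disj by metis
  have D_b_verts: "x \<in> verts T" if "x \<in> D b" for x
    using that below_cases(1)[of x "tail T b"] ab by (cases "x = tail T b") (auto simp: D_def)
  have f_verts: "f x \<in> verts T" if "x \<in> verts T" for x
    using that f_out[of x] f_in(2)[of x] D_b_verts by metis
  \<comment> \<open>The image arrow is forced: only one arrow leaves
    \<open>f (tail T e)\<close>.\<close>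
  define g where "g e = (if tail T e \<in> D a then up (f (tail T e)) else e)" for e
  have g: "g e \<in> arcs T \<and> tail T (g e) = f (tail T e) \<and> head T (g e) = f (head T e) \<and> snd F (g e) = snd F e"
    if e: "e \<in> arcs T" for e
  proof (cases "tail T e \<in> D a")
    case False
    then have "head T e \<notin> D a" using D_down e by blast
    then show ?thesis using False e f_out by (simp add: g_def)
  next
    case True
    show ?thesis
    proof (cases "tail T e = tail T a")
      case True
      then have "e = a" using arc_eqI ab e by blast
      moreover have "g a = b" using f_tail arc ab by (auto simp: g_def D_def)
      ultimately show ?thesis using ab f_tail f_out[OF head_D[of a]] by simp
    next
      case False
      then obtain d where d: "d \<in> arcs T" "tail T d = f (tail T e)" "head T d = f (head T (up (tail T e)))"
        "snd F d = snd F (up (tail T e))"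
        using f[of "tail T e"] True by (auto simp: P_def)
      then have "g e = d" using arc[of d] True by (simp add: g_def)
      then show ?thesis using d arc[OF e] by simp
    qed
  qed
  have "g (g e) = g e" if "e \<in> arcs T" for e
    using g[OF that] f_notin by (simp add: g_def)
  moreover have "fst F (f n) = fst F n" for n
    using f_in(1)[of n] f_out[of n] S(1) by (cases "n \<in> D a") (auto simp: simulation_def)
  ultimately have "retraction T F (f, g)"
    using g f_verts f_notin f_out by (auto simp: retraction_iff)
  moreover have "f (tail T a) \<noteq> tail T a" using f_tail ab arc_eqI by metis
  then have "\<not> morphism_eq T (f, g) (id, id)" using ab by (auto simp: morphism_eq_def)
  ultimately show ?thesis by blast
qed

section \<open>From idempotent matrices back to retractions\<close>

lemma idempotent_matrix_trivial:
  fixes c :: "'n \<Rightarrow> 'n \<Rightarrow> 'k::field"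
  assumes c: "idempotent_matrix T F c"
    and no_retraction: "\<And>\<iota>. retraction T F \<iota> \<Longrightarrow> morphism_eq T \<iota> (id, id)"
  shows "trivial_matrix T c"
proof -
  \<comment> \<open>The matrix is arbitrary here because the claim is applied to the given one and
    to its complement.\<close>
  have zero: "\<forall>k\<in>verts T. \<forall>n\<in>verts T. c k n = 0"
    if c: "idempotent_matrix T F c" and cr: "c r r \<noteq> 1" for c :: "'n \<Rightarrow> 'n \<Rightarrow> 'k"
  proof -
    \<comment> \<open>\<open>(n, k) \<in> R\<close> means that \<open>v\<^sub>k\<close> occurs in
      the image of \<open>v\<^sub>n\<close>; the indices are swapped relative to
      \<open>c k n\<close>.\<close>
    define R where "R = {(n, k). n \<in> verts T \<and> k \<in> verts T \<and> c k n \<noteq> 0}"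
    \<comment> \<open>Only \<open>a\<close> leaves its tail, so one side of the commutation
      condition is a single entry.\<close>
    have up_eq: "(\<Sum>b | b \<in> arcs T \<and> head T b = k \<and> snd F b = snd F a. c (tail T b) (tail T a)) =
        c k (head T a)" if "k \<in> verts T" "a \<in> arcs T" for k a
    proof -
      have "{b \<in> arcs T. tail T b = tail T a \<and> snd F b = snd F a} = {a}"
        using that(2) arc_eqI by auto
      moreover have "(\<Sum>b | b \<in> arcs T \<and> head T b = k \<and> snd F b = snd F a. c (tail T b) (tail T a)) =
        (\<Sum>b | b \<in> arcs T \<and> tail T b = tail T a \<and> snd F b = snd F a. c k (head T b))"
        using c that unfolding idempotent_matrix_def by simp
      ultimately show ?thesis by simp
    qed
    have sim: "simulation F R"
      unfolding simulation_def
    proof (intro ballI, clarify)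
      fix n k assume nk: "(n, k) \<in> R"
      then have R: "n \<in> verts T" "k \<in> verts T" "c k n \<noteq> 0" by (auto simp: R_def)
      have "\<exists>b\<in>arcs T. head T b = k \<and> snd F b = snd F a \<and> (tail T a, tail T b) \<in> R"
        if a: "a \<in> arcs T" "head T a = n" for a
      proof -
        have "(\<Sum>b | b \<in> arcs T \<and> head T b = k \<and> snd F b = snd F a. c (tail T b) (tail T a)) \<noteq> 0"
          using up_eq[of k a] a R by simp
        then obtain b where "b \<in> {b \<in> arcs T. head T b = k \<and> snd F b = snd F a}"
          "c (tail T b) (tail T a) \<noteq> 0" by (rule sum.not_neutral_contains_not_neutral)
        then show ?thesis using a by (auto simp: R_def)
      qed
      then show "fst F n = fst F k \<and> (\<forall>a\<in>arcs T. head T a = n \<longrightarrow>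
          (\<exists>b\<in>arcs T. head T b = k \<and> snd F b = snd F a \<and> (tail T a, tail T b) \<in> R))"
        using c R unfolding idempotent_matrix_def by auto
    qed
    note sim' = simulation_rtrancl[OF sim]
    \<comment> \<open>Otherwise the branch at \<open>tail T a\<close> would fold onto its sibling by
      a non-identity retraction.\<close>
    have sib: "a = b" if "a \<in> arcs T" "b \<in> arcs T" "head T a = head T b" "snd F a = snd F b"
      "(tail T a, tail T b) \<in> R\<^sup>*" for a b
      using simulation_siblings_retraction[OF sim' that(5,1,2) _ that(3,4)] no_retraction by blast
    \<comment> \<open>By \<open>sib\<close> only the diagonal term survives in \<open>up_eq\<close>,
      so a child has the same diagonal entry as its parent.\<close>
    have diag: "c n n = c r r" if "n \<in> verts T" for n
      using that
    proof (induction rule: parent_induct)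
      case (child a)
      have "c (tail T b) (tail T a) = 0" if "b \<in> arcs T" "head T b = head T a" "snd F b = snd F a" "b \<noteq> a" for b
      proof (rule ccontr)
        assume "c (tail T b) (tail T a) \<noteq> 0"
        then have "(tail T a, tail T b) \<in> R" using that child(1) by (simp add: R_def)
        then show False using sib[of a b] that child(1) by auto
      qed
      then have "(\<Sum>b | b \<in> arcs T \<and> head T b = head T a \<and> snd F b = snd F a. c (tail T b) (tail T a)) =
          (\<Sum>b\<in>{a}. c (tail T b) (tail T a))"
        by (intro sum.mono_neutral_right) (use child(1) in auto)
      then show ?case using up_eq[of "head T a" a] child by simp
    qed simp
    \<comment> \<open>The root is related at most to itself, so \<open>c r r\<close> is an
      idempotent element of the field, and it differs from \<open>1\<close>.\<close>
    have "c r r = (\<Sum>m\<in>verts T. c r m * c m r)" using c root by (simp add: idempotent_matrix_def)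
    also have "\<dots> = (\<Sum>m\<in>{r}. c r m * c m r)"
    proof (rule sum.mono_neutral_right)
      show "\<forall>m\<in>verts T - {r}. c r m * c m r = 0"
        using simulation_root[OF sim] root by (auto simp: R_def)
    qed (use root in auto)
    finally have "c r r = 0" using cr by simp
    then have irrefl: "(n, n) \<notin> R" for n using diag by (auto simp: R_def)
    text \<open>By \<open>sib\<close>, at most one term of the commutation relation survives on the side of \<open>y\<close>.\<close>
    have parents: "x \<noteq> r \<and> (head T (up x), head T (up y)) \<in> R \<and> snd F (up x) = snd F (up y)"
      if xy: "(x, y) \<in> R" "(y, x) \<in> R\<^sup>*" "y \<noteq> r" for x y
    proof -
      have x: "x \<in> verts T" and y: "y \<in> verts T" "c y x \<noteq> 0" using xy by (auto simp: R_def)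
      define b where "b = up y"
      have b: "b \<in> arcs T" "tail T b = y" using up[OF y(1) xy(3)] by (auto simp: b_def)
      have "c (tail T d) x = 0" if d: "d \<in> arcs T" "head T d = head T b" "snd F d = snd F b" "d \<noteq> b" for d
      proof (rule ccontr)
        assume "c (tail T d) x \<noteq> 0"
        then have "(x, tail T d) \<in> R" using x d by (auto simp: R_def)
        with xy(2) have "(tail T b, tail T d) \<in> R\<^sup>*" using b by (auto intro: rtrancl_into_rtrancl)
        then show False using sib[of b d] b d by auto
      qed
      then have "(\<Sum>d | d \<in> arcs T \<and> head T d = head T b \<and> snd F d = snd F b. c (tail T d) x) =
          (\<Sum>d\<in>{b}. c (tail T d) x)"
        by (intro sum.mono_neutral_right) (use b in auto)
      moreover have "(\<Sum>d | d \<in> arcs T \<and> head T d = head T b \<and> snd F d = snd F b. c (tail T d) x) =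
          (\<Sum>a | a \<in> arcs T \<and> tail T a = x \<and> snd F a = snd F b. c (head T b) (head T a))"
        using c x b unfolding idempotent_matrix_def by simp
      ultimately have "(\<Sum>a | a \<in> arcs T \<and> tail T a = x \<and> snd F a = snd F b. c (head T b) (head T a)) \<noteq> 0"
        using y b by simp
      then obtain a where "a \<in> {a \<in> arcs T. tail T a = x \<and> snd F a = snd F b}" "c (head T b) (head T a) \<noteq> 0"
        by (rule sum.not_neutral_contains_not_neutral)
      then show ?thesis using arc[of a] b by (auto simp: R_def b_def)
    qed
    \<comment> \<open>That \<open>y\<close> leads back to \<open>x\<close> puts every link of the
      chain on a cycle, as \<open>parents\<close> requires.\<close>
    have parents_rtrancl: "(y, x) \<in> R\<^sup>* \<longrightarrow> y \<noteq> r \<longrightarrow> (head T (up x), head T (up y)) \<in> R\<^sup>*"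
      if "(x, y) \<in> R\<^sup>*" for x y
      using that
    proof (induction rule: rtrancl_induct)
      case (step y z)
      show ?case
      proof (intro impI)
        assume z: "(z, x) \<in> R\<^sup>*" "z \<noteq> r"
        have "y \<noteq> r \<and> (head T (up y), head T (up z)) \<in> R"
          using parents[of y z] step.hyps z by (meson rtrancl_trans)
        moreover have "(y, x) \<in> R\<^sup>*" using step.hyps z by (meson converse_rtrancl_into_rtrancl)
        ultimately show "(head T (up x), head T (up z)) \<in> R\<^sup>*"
          using step.IH by (meson rtrancl.rtrancl_into_rtrancl)
      qed
    qed simp
    \<comment> \<open>A cycle through \<open>tail T a\<close> is carried to one through
      \<open>head T a\<close>. At the root only a loop is possible, and \<open>irrefl\<close>
      excludes it.\<close>
    have no_cycle: "\<forall>k. (n, k) \<in> R \<longrightarrow> (k, n) \<notin> R\<^sup>*" if "n \<in> verts T" for n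
      using that
    proof (induction rule: parent_induct)
      case root
      then show ?case using simulation_root[OF sim] irrefl by (auto simp: R_def)
    next
      case (child a)
      show ?case
      proof (intro allI impI notI)
        fix k assume k: "(tail T a, k) \<in> R" "(k, tail T a) \<in> R\<^sup>*"
        have "k \<noteq> r"
          using simulation_root[OF sim', of "tail T a"] k(2) arc child(1) by auto
        then have "(head T a, head T (up k)) \<in> R" "(head T (up k), head T a) \<in> R\<^sup>*"
          using parents[OF k] parents_rtrancl[OF k(2)] k(1) arc[OF child(1)] by auto
        then show False using child(2) by blast
      qed
    qed
    have "acyclic R"
    proof (rule acyclicI, intro allI notI)
      fix x assume "(x, x) \<in> R\<^sup>+"
      then obtain y where "(x, y) \<in> R" "(y, x) \<in> R\<^sup>*" by (meson tranclD)
      then show False using no_cycle[of x] by (auto simp: R_def)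
    qed
    moreover have "finite R"
      by (rule finite_subset[of _ "verts T \<times> verts T"]) (auto simp: R_def)
    ultimately have "wf (R\<inverse>)" by (simp add: finite_acyclic_wf_converse)
    \<comment> \<open>In the expansion of \<open>c k n\<close> by idempotency, a nonzero factor
      \<open>c m n\<close> gives \<open>(n, m) \<in> R\<close>, and then \<open>c k m\<close>
      vanishes by induction.\<close>
    then have "n \<in> verts T \<longrightarrow> (\<forall>k\<in>verts T. c k n = 0)" for n
    proof (induction n rule: wf_induct_rule)
      case (less n)
      have "c k n = 0" if "n \<in> verts T" "k \<in> verts T" for k
      proof -
        have "c k n = (\<Sum>m\<in>verts T. c k m * c m n)" using c that by (simp add: idempotent_matrix_def)
        also have "\<dots> = 0" using less.IH that by (intro sum.neutral) (auto simp: R_def)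
        finally show ?thesis .
      qed
      then show ?case by blast
    qed
    then show ?thesis by blast
  qed
  show ?thesis
  proof (cases "c r r = 1")
    case True
    have "of_bool (k = n) - c k n = 0" if "k \<in> verts T" "n \<in> verts T" for k n
      using zero[OF idempotent_matrix_complement[OF fin_digraph_axioms c]] True that by auto
    then show ?thesis by (auto simp: trivial_matrix_def)
  qed (use zero[OF c] in \<open>auto simp: trivial_matrix_def\<close>)
qed

lemma retraction_iff_idempotent_matrix:
  "(\<exists>\<iota>. retraction T F \<iota> \<and> \<not> morphism_eq T \<iota> (id, id)) \<longleftrightarrow>
   (\<exists>c :: 'n \<Rightarrow> 'n \<Rightarrow> 'k::field. idempotent_matrix T F c \<and> \<not> trivial_matrix T c)"
proof
  assume "\<exists>\<iota>. retraction T F \<iota> \<and> \<not> morphism_eq T \<iota> (id, id)"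
  then obtain f g where "retraction T F (f, g)" "\<not> morphism_eq T (f, g) (id, id)" by auto
  then show "\<exists>c :: 'n \<Rightarrow> 'n \<Rightarrow> 'k. idempotent_matrix T F c \<and> \<not> trivial_matrix T c"
    using retraction_idempotent_matrix[of F f g, where ?'k = 'k]
      retraction_trivial_matrix[of F f g, where ?'k = 'k] by blast
next
  assume "\<exists>c :: 'n \<Rightarrow> 'n \<Rightarrow> 'k. idempotent_matrix T F c \<and> \<not> trivial_matrix T c"
  then show "\<exists>\<iota>. retraction T F \<iota> \<and> \<not> morphism_eq T \<iota> (id, id)"
    using idempotent_matrix_trivial by blast
qed

end

text \<open>A unique source becomes a unique sink under reversal, and both sides of the equivalence
  are invariant under reversal.\<close>

lemma rooted_tree_retraction_iff_idempotent_matrix: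
  fixes T :: "('n, 'e) pre_digraph"
  assumes "rooted_tree T"
  shows "(\<exists>\<iota>. retraction T F \<iota> \<and> \<not> morphism_eq T \<iota> (id, id)) \<longleftrightarrow>
    (\<exists>c :: 'n \<Rightarrow> 'n \<Rightarrow> 'k::field. idempotent_matrix T F c \<and> \<not> trivial_matrix T c)"
proof -
  from assms have T: "fin_digraph T" "all_bridges T"
    by (auto simp: rooted_tree_def quiver_tree_all_bridges quiver_tree_def)
  consider "\<exists>!r. r \<in> verts T \<and> out_arcs T r = {}" | "\<exists>!r. r \<in> verts T \<and> in_arcs T r = {}"
    using assms unfolding rooted_tree_def by blast
  then show ?thesis
  proof cases
    case 1
    then obtain r up where "in_tree T r up"
      using all_bridges_unique_sink_in_tree T by blast
    then show ?thesis by (rule in_tree.retraction_iff_idempotent_matrix)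
  next
    case 2
    then have "\<exists>!r. r \<in> verts (opposite T) \<and> out_arcs (opposite T) r = {}"
      by (simp add: in_arcs_def out_arcs_def)
    then obtain r up where "in_tree (opposite T) r up"
      using all_bridges_unique_sink_in_tree[of "opposite T"] T all_bridges_opposite fin_digraph_opposite by blast
    note in_tree.retraction_iff_idempotent_matrix[OF this, of F, where ?'k = 'k]
    then show ?thesis
      by (simp only: nontrivial_idempotent_matrix_opposite retraction_opposite morphism_eq_def opposite_simps)
  qed
qed


section \<open>Idempotent matrices and direct sum decompositions\<close>

lemma lookup_bvec: "Poly_Mapping.lookup (bvec n) k = of_bool (k = n)"
  by (auto simp: bvec_def lookup_single when_def)

text \<open>Regrouping the defining sum by the heads of the arrows gives the coefficients of the
  result, the form in which the action is compared with a matrix.\<close>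

lemma lookup_tree_module_act:
  fixes m :: "'n \<Rightarrow>\<^sub>0 'k::field"
  assumes "fin_digraph T"
  shows "Poly_Mapping.lookup (act (tree_module T F) \<gamma> m) k =
    (\<Sum>a | a \<in> arcs T \<and> head T a = k \<and> snd F a = \<gamma>. Poly_Mapping.lookup m (tail T a))"
proof -
  interpret fin_digraph T by fact
  let ?x = "Poly_Mapping.lookup m"
  have "Poly_Mapping.lookup (act (tree_module T F) \<gamma> m) k =
      (\<Sum>n\<in>Poly_Mapping.keys m. \<Sum>a | a \<in> arcs T \<and> tail T a = n \<and> snd F a = \<gamma>. ?x n * of_bool (k = head T a))"
    unfolding tree_module_def quiver_rep.simps lookup_sum lookup_fscale lookup_bvec sum_distrib_left ..
  also have "\<dots> = (\<Sum>n\<in>Poly_Mapping.keys m. \<Sum>a\<in>arcs T.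
      if tail T a = n then (if head T a = k \<and> snd F a = \<gamma> then ?x (tail T a) else 0) else 0)"
    by (intro sum.cong sum.mono_neutral_cong_left) auto
  also have "\<dots> = (\<Sum>a\<in>arcs T. \<Sum>n\<in>Poly_Mapping.keys m.
      if tail T a = n then (if head T a = k \<and> snd F a = \<gamma> then ?x (tail T a) else 0) else 0)"
    by (rule sum.swap)
  also have "\<dots> = (\<Sum>a\<in>arcs T. if head T a = k \<and> snd F a = \<gamma> then ?x (tail T a) else 0)"
    by (rule sum.cong) (auto simp: sum.delta' in_keys_iff)
  also have "\<dots> = (\<Sum>a | a \<in> arcs T \<and> head T a = k \<and> snd F a = \<gamma>. ?x (tail T a))"
    by (rule sum.mono_neutral_cong_right) auto
  finally show ?thesis .
qed

definition matrix_map ::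
    "('n, 'e) pre_digraph \<Rightarrow> ('n \<Rightarrow> 'n \<Rightarrow> 'k::field) \<Rightarrow> ('n \<Rightarrow>\<^sub>0 'k) \<Rightarrow> ('n \<Rightarrow>\<^sub>0 'k)" where
  "matrix_map T c x = (\<Sum>k\<in>verts T. Poly_Mapping.single k (\<Sum>n\<in>verts T. c k n * Poly_Mapping.lookup x n))"

lemma lookup_matrix_map:
  assumes "fin_digraph T"
  shows "Poly_Mapping.lookup (matrix_map T c x) k =
    (if k \<in> verts T then \<Sum>n\<in>verts T. c k n * Poly_Mapping.lookup x n else 0)"
proof -
  interpret fin_digraph T by fact
  show ?thesis by (simp add: matrix_map_def lookup_sum lookup_single when_def)
qed

lemma lookup_matrix_map_act:
  assumes "fin_digraph T"
  shows "Poly_Mapping.lookup (matrix_map T c (act (tree_module T F) \<gamma> x)) k =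
    (if k \<in> verts T then \<Sum>a | a \<in> arcs T \<and> snd F a = \<gamma>. c k (head T a) * Poly_Mapping.lookup x (tail T a) else 0)"
proof -
  interpret fin_digraph T by fact
  have "(\<Sum>n\<in>verts T. c k n *
      (\<Sum>a | a \<in> arcs T \<and> head T a = n \<and> snd F a = \<gamma>. Poly_Mapping.lookup x (tail T a))) =
    (\<Sum>n\<in>verts T. \<Sum>a | a \<in> {a \<in> arcs T. snd F a = \<gamma>} \<and> head T a = n.
      c k (head T a) * Poly_Mapping.lookup x (tail T a))"
    unfolding sum_distrib_left by (intro sum.cong) auto
  also have "\<dots> = (\<Sum>a | a \<in> arcs T \<and> snd F a = \<gamma>. c k (head T a) * Poly_Mapping.lookup x (tail T a))"
    by (rule sum.group) auto
  finally show ?thesis by (simp add: lookup_matrix_map[OF assms] lookup_tree_module_act[OF assms])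
qed

text \<open>Grouping the arrows by their tails produces the sums over arrows leaving
  \<open>n\<close>; the commutation condition replaces them by sums over arrows entering
  \<open>k\<close>.\<close>

lemma matrix_map_act:
  fixes x :: "'n \<Rightarrow>\<^sub>0 'k::field"
  assumes "fin_digraph T" "idempotent_matrix T F c"
  shows "matrix_map T c (act (tree_module T F) \<gamma> x) = act (tree_module T F) \<gamma> (matrix_map T c x)"
proof (rule poly_mapping_eqI)
  interpret fin_digraph T by fact
  let ?x = "Poly_Mapping.lookup x"
  fix k
  show "Poly_Mapping.lookup (matrix_map T c (act (tree_module T F) \<gamma> x)) k =
      Poly_Mapping.lookup (act (tree_module T F) \<gamma> (matrix_map T c x)) k"
  proof (cases "k \<in> verts T")
    case True
    have "(\<Sum>a | a \<in> arcs T \<and> snd F a = \<gamma>. c k (head T a) * ?x (tail T a)) =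
        (\<Sum>n\<in>verts T. \<Sum>a | a \<in> {a \<in> arcs T. snd F a = \<gamma>} \<and> tail T a = n. c k (head T a) * ?x (tail T a))"
      by (rule sum.group[symmetric]) auto
    also have "\<dots> = (\<Sum>n\<in>verts T. (\<Sum>a | a \<in> arcs T \<and> tail T a = n \<and> snd F a = \<gamma>. c k (head T a)) * ?x n)"
      unfolding sum_distrib_right by (intro sum.cong) auto
    also have "\<dots> = (\<Sum>n\<in>verts T. (\<Sum>a | a \<in> arcs T \<and> head T a = k \<and> snd F a = \<gamma>. c (tail T a) n) * ?x n)"
      using assms(2) True by (intro sum.cong) (auto simp: idempotent_matrix_def)
    also have "\<dots> = (\<Sum>a | a \<in> arcs T \<and> head T a = k \<and> snd F a = \<gamma>. \<Sum>n\<in>verts T. c (tail T a) n * ?x n)"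
      unfolding sum_distrib_right by (rule sum.swap)
    also have "\<dots> = Poly_Mapping.lookup (act (tree_module T F) \<gamma> (matrix_map T c x)) k"
      unfolding lookup_tree_module_act[OF assms(1)] lookup_matrix_map[OF assms(1)]
      by (rule sum.cong) auto
    finally show ?thesis using True by (simp add: lookup_matrix_map_act[OF assms(1)])
  next
    case False
    then have "{a \<in> arcs T. head T a = k \<and> snd F a = \<gamma>} = {}" by auto
    then show ?thesis using False
      unfolding lookup_matrix_map_act[OF assms(1)] lookup_tree_module_act[OF assms(1)]
      by (simp only: if_False sum.empty)
  qed
qed

lemma tree_module_space_iff:
  fixes x :: "'n \<Rightarrow>\<^sub>0 'k::field"
  shows "x \<in> space_at (tree_module T F) y \<longleftrightarrow>
    (\<forall>k. Poly_Mapping.lookup x k \<noteq> 0 \<longrightarrow> k \<in> verts T \<and> fst F k = y)"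
  unfolding tree_module_space by (auto simp: in_keys_iff)

lemma matrix_map_idem:
  fixes x :: "'n \<Rightarrow>\<^sub>0 'k::field"
  assumes "fin_digraph T" "idempotent_matrix T F c"
  shows "matrix_map T c (matrix_map T c x) = matrix_map T c x"
proof (rule poly_mapping_eqI)
  interpret fin_digraph T by fact
  let ?x = "Poly_Mapping.lookup x"
  fix k
  have "(\<Sum>m\<in>verts T. c k m * (\<Sum>n\<in>verts T. c m n * ?x n)) =
      (\<Sum>n\<in>verts T. (\<Sum>m\<in>verts T. c k m * c m n) * ?x n)"
    unfolding sum_distrib_left sum_distrib_right mult.assoc by (rule sum.swap)
  then show "Poly_Mapping.lookup (matrix_map T c (matrix_map T c x)) k = Poly_Mapping.lookup (matrix_map T c x) k"
    using assms(2) by (simp add: lookup_matrix_map[OF assms(1)] idempotent_matrix_def)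
qed

lemma matrix_map_add:
  assumes "fin_digraph T"
  shows "matrix_map T c (x + y) = matrix_map T c x + matrix_map T c y"
  by (rule poly_mapping_eqI) (simp add: lookup_matrix_map[OF assms] lookup_add distrib_left sum.distrib)

lemma matrix_map_diff:
  assumes "fin_digraph T"
  shows "matrix_map T c (x - y) = matrix_map T c x - matrix_map T c y"
  using matrix_map_add[OF assms, of c "x - y" y] by (simp add: algebra_simps)

lemma matrix_map_fscale:
  assumes "fin_digraph T"
  shows "matrix_map T c (fscale d x) = fscale d (matrix_map T c x)"
  by (rule poly_mapping_eqI) (simp add: lookup_matrix_map[OF assms] sum_distrib_left mult.left_commute)

lemma matrix_map_space:
  fixes x :: "'n \<Rightarrow>\<^sub>0 'k::field"
  assumes "fin_digraph T" "idempotent_matrix T F c" "x \<in> space_at (tree_module T F) y"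
  shows "matrix_map T c x \<in> space_at (tree_module T F) y"
  unfolding tree_module_space_iff
proof (intro allI impI)
  fix k assume k: "Poly_Mapping.lookup (matrix_map T c x) k \<noteq> 0"
  then have kV: "k \<in> verts T" by (auto simp: lookup_matrix_map[OF assms(1)] split: if_splits)
  with k have "(\<Sum>n\<in>verts T. c k n * Poly_Mapping.lookup x n) \<noteq> 0"
    by (simp add: lookup_matrix_map[OF assms(1)])
  then obtain n where "n \<in> verts T" "c k n * Poly_Mapping.lookup x n \<noteq> 0"
    by (rule sum.not_neutral_contains_not_neutral)
  then show "k \<in> verts T \<and> fst F k = y"
    using kV assms(2,3) unfolding tree_module_space_iff idempotent_matrix_def by auto
qed

lemma matrix_map_bvec:
  assumes "fin_digraph T" "n \<in> verts T" "k \<in> verts T"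
  shows "Poly_Mapping.lookup (matrix_map T c (bvec n)) k = c k n"
proof -
  interpret fin_digraph T by fact
  have "(\<Sum>m\<in>verts T. c k m * of_bool (m = n)) = (\<Sum>m\<in>{n}. c k m)"
    by (rule sum.mono_neutral_cong_right) (use assms in auto)
  then show ?thesis using assms by (simp add: lookup_matrix_map[OF assms(1)] lookup_bvec)
qed

section \<open>Direct sum decompositions and projections\<close>

lemma bvec_space: "n \<in> verts T \<Longrightarrow> (bvec n :: 'n \<Rightarrow>\<^sub>0 'k::field) \<in> space_at (tree_module T F) (fst F n)"
  by (simp add: tree_module_space_iff lookup_bvec)

text \<open>An idempotent endomorphism splits the module into its image \<open>A\<close>, described
  by the fixed vectors, and its kernel \<open>B\<close>. One of them vanishes, and evaluation at
  basis vectors yields the zero or the identity matrix.\<close>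

lemma indecomposable_trivial_matrix:
  fixes c :: "'n \<Rightarrow> 'n \<Rightarrow> 'k::field"
  assumes T: "fin_digraph T" and F: "quiver_morphism T Q F"
    and c: "idempotent_matrix T F c"
    and M: "indecomposable fscale Q \<rho> (tree_module T F :: ('v, 'a, 'n \<Rightarrow>\<^sub>0 'k) quiver_rep)"
  shows "trivial_matrix T c"
proof -
  interpret vs: vector_space "fscale :: 'k \<Rightarrow> ('n \<Rightarrow>\<^sub>0 'k) \<Rightarrow> _" by (rule vector_space_fscale)
  let ?M = "tree_module T F :: ('v, 'a, 'n \<Rightarrow>\<^sub>0 'k) quiver_rep"
  let ?e = "matrix_map T c"
  note e_simps = matrix_map_add[OF T] matrix_map_diff[OF T] matrix_map_fscale[OF T] matrix_map_idem[OF T c]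
  have rep: "representation fscale Q \<rho> ?M" using M by (simp add: indecomposable_def)
  have sub: "vs.subspace (space_at ?M y)" for y by (simp add: tree_module_def)
  have e0: "?e 0 = 0" using matrix_map_diff[OF T, of c 0 0] by simp
  define A where "A y = {x \<in> space_at ?M y. ?e x = x}" for y
  define B where "B y = {x \<in> space_at ?M y. ?e x = 0}" for y
  have act_space: "act ?M \<gamma> x \<in> space_at ?M (head Q \<gamma>)"
    if "\<gamma> \<in> arcs Q" "x \<in> space_at ?M (tail Q \<gamma>)" for \<gamma> x
    using rep that by (simp add: representation_def)
  have act0: "act ?M \<gamma> 0 = 0" for \<gamma>
    by (rule poly_mapping_eqI) (simp add: lookup_tree_module_act[OF T])
  have "subrepresentation fscale Q A ?M"
    unfolding subrepresentation_def
  proof (intro conjI ballI)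
    show "vs.subspace (A y)" for y
      by (rule vs.subspaceI) (use vs.subspace_0[OF sub] vs.subspace_add[OF sub] vs.subspace_scale[OF sub] in
        \<open>auto simp: A_def e_simps e0\<close>)
    show "act ?M \<gamma> ` A (tail Q \<gamma>) \<subseteq> A (head Q \<gamma>)" if "\<gamma> \<in> arcs Q" for \<gamma>
      using that act_space by (auto simp: A_def matrix_map_act[OF T c])
  qed (auto simp: A_def)
  moreover have "subrepresentation fscale Q B ?M"
    unfolding subrepresentation_def
  proof (intro conjI ballI)
    show "vs.subspace (B y)" for y
      by (rule vs.subspaceI) (use vs.subspace_0[OF sub] vs.subspace_add[OF sub] vs.subspace_scale[OF sub] in
        \<open>auto simp: B_def e_simps e0\<close>)
    show "act ?M \<gamma> ` B (tail Q \<gamma>) \<subseteq> B (head Q \<gamma>)" if "\<gamma> \<in> arcs Q" for \<gamma>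
      using that act_space by (auto simp: B_def matrix_map_act[OF T c] act0)
  qed (auto simp: B_def)
  moreover have split: "?e x \<in> A y" "x - ?e x \<in> B y" if "x \<in> space_at ?M y" for x y
    using that matrix_map_space[OF T c that] vs.subspace_diff[OF sub that]
    by (auto simp: A_def B_def e_simps)
  have "internal_direct_sum Q ?M A B"
    unfolding internal_direct_sum_def
  proof (intro ballI conjI equalityI subsetI)
    fix y x assume "x \<in> space_at ?M y"
    note split[OF this]
    moreover have "x = ?e x + (x - ?e x)" by simp
    ultimately show "x \<in> {a + b |a b. a \<in> A y \<and> b \<in> B y}" by blast
  next
    fix y x assume "x \<in> {a + b |a b. a \<in> A y \<and> b \<in> B y}"
    then show "x \<in> space_at ?M y" using vs.subspace_add[OF sub] by (auto simp: A_def B_def)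
  qed (use vs.subspace_0[OF sub] e0 in \<open>auto simp: A_def B_def\<close>)
  ultimately have "zero_family Q A \<or> zero_family Q B"
    using M unfolding indecomposable_def by blast
  moreover have Fn: "fst F n \<in> verts Q" if "n \<in> verts T" for n
    using F that by (simp add: quiver_morphism_def)
  ultimately show ?thesis
  proof (elim disjE)
    assume "zero_family Q A"
    then have "?e (bvec n) = 0" if "n \<in> verts T" for n
      using split(1)[OF bvec_space[OF that]] Fn[OF that] by (simp add: zero_family_def)
    then have "c k n = 0" if "n \<in> verts T" "k \<in> verts T" for n k
      using that matrix_map_bvec[OF T that, of c] by simp
    then show ?thesis by (auto simp: trivial_matrix_def)
  next
    assume "zero_family Q B"
    then have "?e (bvec n) = bvec n" if "n \<in> verts T" for n
      using split(2)[OF bvec_space[OF that]] Fn[OF that] by (simp add: zero_family_def)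
    then have "c k n = of_bool (k = n)" if "n \<in> verts T" "k \<in> verts T" for n k
      using that matrix_map_bvec[OF T that, of c] by (simp add: lookup_bvec)
    then show ?thesis by (auto simp: trivial_matrix_def)
  qed
qed

text \<open>For a decomposition into \<open>A\<close> and \<open>B\<close>, the projection onto
  \<open>A\<close> along \<open>B\<close> commutes with all arrows, so its matrix is idempotent and
  hence trivial. The zero matrix makes \<open>A\<close> vanish, the identity matrix makes
  \<open>B\<close> vanish.\<close>

lemma trivial_matrix_indecomposable:
  fixes F :: "('n \<Rightarrow> 'v) \<times> ('e \<Rightarrow> 'a)"
  assumes Q: "wf_digraph Q" and T: "fin_digraph T" and ne: "verts T \<noteq> {}" and bound: "bound_morphism TYPE('k::field) Q \<rho> T F"
    and trivial: "\<And>c :: 'n \<Rightarrow> 'n \<Rightarrow> 'k. idempotent_matrix T F c \<Longrightarrow> trivial_matrix T c"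
  shows "indecomposable fscale Q \<rho> (tree_module T F :: ('v, 'a, 'n \<Rightarrow>\<^sub>0 'k) quiver_rep)"
proof -
  interpret fin_digraph T by (rule T)
  interpret vs: vector_space "fscale :: 'k \<Rightarrow> ('n \<Rightarrow>\<^sub>0 'k) \<Rightarrow> _" by (rule vector_space_fscale)
  let ?M = "tree_module T F :: ('v, 'a, 'n \<Rightarrow>\<^sub>0 'k) quiver_rep"
  have F: "quiver_morphism T Q F" using bound by (simp add: bound_morphism_def)
  have rep: "representation fscale Q \<rho> ?M" using T bound by (rule tree_module_representation)
  have FV: "fst F n \<in> verts Q" if "n \<in> verts T" for n
    using F that by (simp add: quiver_morphism_def)
  obtain n0 where "n0 \<in> verts T" using ne by blast
  moreover have "Poly_Mapping.lookup (bvec n0 :: 'n \<Rightarrow>\<^sub>0 'k) n0 \<noteq> 0" by (simp add: lookup_bvec)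
  then have "(bvec n0 :: 'n \<Rightarrow>\<^sub>0 'k) \<noteq> 0" by (metis lookup_zero)
  ultimately have nonzero: "\<not> zero_family Q (space_at ?M)"
    using bvec_space[of n0 T F, where ?'k = 'k] FV unfolding zero_family_def by fastforce
  have "zero_family Q A \<or> zero_family Q B"
    if A: "subrepresentation fscale Q A ?M" and B: "subrepresentation fscale Q B ?M"
      and AB: "internal_direct_sum Q ?M A B" for A B
  proof -
    have subA: "vs.subspace (A y)" "A y \<subseteq> space_at ?M y"
      and subB: "vs.subspace (B y)" "B y \<subseteq> space_at ?M y"
      and int: "A y \<inter> B y = {0}" if "y \<in> verts Q" for y
      using A[unfolded subrepresentation_def] B[unfolded subrepresentation_def]
        AB[unfolded internal_direct_sum_def] that by simp_all
    have "\<exists>a. a \<in> A (fst F n) \<and> bvec n - a \<in> B (fst F n)" if "n \<in> verts T" for n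
    proof -
      have "bvec n \<in> {a + b | a b. a \<in> A (fst F n) \<and> b \<in> B (fst F n)}"
        using AB FV[OF that] bvec_space[OF that, of F, where ?'k = 'k] unfolding internal_direct_sum_def by blast
      then obtain a b where "bvec n = a + b" "a \<in> A (fst F n)" "b \<in> B (fst F n)" by blast
      then show ?thesis by (intro exI[of _ a]) simp
    qed
    then obtain p where p: "p n \<in> A (fst F n)" "bvec n - p n \<in> B (fst F n)" if "n \<in> verts T" for n
      by metis
    \<comment> \<open>The columns are the \<open>A\<close>-components of the basis vectors, so
      \<open>matrix_map T c\<close> acts on the module as the projection onto \<open>A\<close> along
      \<open>B\<close>.\<close>
    define c where "c k n = Poly_Mapping.lookup (p n) k" for k n
    have c_zero: "k \<in> verts T \<and> fst F k = fst F n" if "n \<in> verts T" "c k n \<noteq> 0" for k n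
    proof -
      have "p n \<in> space_at ?M (fst F n)" using subA(2)[OF FV[OF that(1)]] p(1)[OF that(1)] by (rule subsetD)
      then show ?thesis using that(2) by (simp add: tree_module_space_iff c_def)
    qed
    let ?e = "matrix_map T c"
    have e_eq: "?e x = (\<Sum>n\<in>verts T. fscale (Poly_Mapping.lookup x n) (p n))" for x
    proof (rule poly_mapping_eqI)
      fix k
      have "(\<Sum>n\<in>verts T. c k n * Poly_Mapping.lookup x n) = 0" if "k \<notin> verts T"
        by (rule sum.neutral) (use c_zero that in auto)
      then show "Poly_Mapping.lookup (?e x) k =
          Poly_Mapping.lookup (\<Sum>n\<in>verts T. fscale (Poly_Mapping.lookup x n) (p n)) k"
        by (simp add: lookup_matrix_map[OF T] lookup_sum c_def mult.commute)
    qed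
    have eA: "?e x \<in> A y" and eB: "x - ?e x \<in> B y" if y: "y \<in> verts Q" and x: "x \<in> space_at ?M y" for x y
    proof -
      have x_col: "Poly_Mapping.lookup x n = 0 \<or> fst F n = y" for n
        using x by (auto simp: tree_module_space_iff)
      show "?e x \<in> A y" unfolding e_eq
      proof (rule vs.subspace_sum[OF subA(1)[OF y]])
        show "fscale (Poly_Mapping.lookup x n) (p n) \<in> A y" if "n \<in> verts T" for n
          using x_col[of n] p(1)[OF that] vs.subspace_scale[OF subA(1)[OF y]] vs.subspace_0[OF subA(1)[OF y]]
          by auto
      qed
      have "x = (\<Sum>n\<in>verts T. fscale (Poly_Mapping.lookup x n) (bvec n))"
      proof (rule poly_mapping_eqI)
        fix k
        have "(\<Sum>n\<in>verts T. Poly_Mapping.lookup x n * of_bool (k = n)) =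
            (\<Sum>n\<in>verts T. if k = n then Poly_Mapping.lookup x k else 0)"
          by (rule sum.cong) auto
        then show "Poly_Mapping.lookup x k =
            Poly_Mapping.lookup (\<Sum>n\<in>verts T. fscale (Poly_Mapping.lookup x n) (bvec n)) k"
          using x by (auto simp: lookup_sum lookup_bvec tree_module_space_iff)
      qed
      then have "x - ?e x = (\<Sum>n\<in>verts T. fscale (Poly_Mapping.lookup x n) (bvec n)) -
          (\<Sum>n\<in>verts T. fscale (Poly_Mapping.lookup x n) (p n))" by (metis e_eq)
      then have "x - ?e x = (\<Sum>n\<in>verts T. fscale (Poly_Mapping.lookup x n) (bvec n - p n))"
        by (simp add: sum_subtractf vs.scale_right_diff_distrib)
      moreover have "\<dots> \<in> B y"
      proof (rule vs.subspace_sum[OF subB(1)[OF y]])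
        show "fscale (Poly_Mapping.lookup x n) (bvec n - p n) \<in> B y" if "n \<in> verts T" for n
          using x_col[of n] p(2)[OF that] vs.subspace_scale[OF subB(1)[OF y]] vs.subspace_0[OF subB(1)[OF y]]
          by auto
      qed
      ultimately show "x - ?e x \<in> B y" by simp
    qed
    \<comment> \<open>Components are unique: \<open>?e x - a\<close> lies in both \<open>A y\<close>
      and \<open>B y\<close>.\<close>
    have e_unique: "?e x = a" if y: "y \<in> verts Q" and x: "x \<in> space_at ?M y" and a: "a \<in> A y" "x - a \<in> B y"
      for x y a
    proof -
      have "?e x - a \<in> A y" using vs.subspace_diff[OF subA(1)] eA y x a by blast
      moreover have "(x - a) - (x - ?e x) \<in> B y" using vs.subspace_diff[OF subB(1)] eB y x a by blast
      then have "?e x - a \<in> B y" by simp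
      ultimately have "?e x - a \<in> {0}" using int[OF y] by blast
      then show ?thesis by simp
    qed
    have e_A: "?e x = x" if "y \<in> verts Q" "x \<in> A y" for x y
      using e_unique[of y x x] that subA(2) vs.subspace_0[OF subB(1)] by auto
    have e_B: "?e x = 0" if "y \<in> verts Q" "x \<in> B y" for x y
      using e_unique[of y x 0] that subB(2) vs.subspace_0[OF subA(1)] by auto
    have "idempotent_matrix T F c"
      unfolding idempotent_matrix_def
    proof (intro conjI allI ballI impI)
      show "fst F k = fst F n" if "n \<in> verts T" "c k n \<noteq> 0" for k n
        using c_zero that by blast
      show "(\<Sum>m\<in>verts T. c k m * c m n) = c k n" if "k \<in> verts T" "n \<in> verts T" for k n
      proof -
        have "Poly_Mapping.lookup (?e (p n)) k = c k n"
          using e_A[OF FV p(1)] that by (simp add: c_def)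
        then show ?thesis using that(1) by (simp add: lookup_matrix_map[OF T] c_def)
      qed
      fix \<gamma> k n assume k: "k \<in> verts T" and n: "n \<in> verts T"
      show "(\<Sum>a | a \<in> arcs T \<and> head T a = k \<and> snd F a = \<gamma>. c (tail T a) n) =
          (\<Sum>a | a \<in> arcs T \<and> tail T a = n \<and> snd F a = \<gamma>. c k (head T a))" (is "?l = ?r")
      \<comment> \<open>\<open>A\<close> and \<open>B\<close> are stable under arrows of
        \<open>Q\<close> applied at their sources. If \<gamma> is no arrow of \<open>Q\<close>
        starting at \<open>fst F n\<close>, both sums vanish.\<close>
      proof (cases "\<gamma> \<in> arcs Q \<and> tail Q \<gamma> = fst F n")
        case True
        then have \<gamma>: "\<gamma> \<in> arcs Q" "tail Q \<gamma> = fst F n" by auto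
        let ?w = "act ?M \<gamma> (bvec n)"
        have w: "?w \<in> space_at ?M (head Q \<gamma>)"
          using rep bvec_space[OF n, of F, where ?'k = 'k] \<gamma> unfolding representation_def by metis
        have head: "head Q \<gamma> \<in> verts Q" using Q \<gamma> by (simp add: wf_digraph.head_in_verts)
        have "act ?M \<gamma> (p n) \<in> A (head Q \<gamma>)"
          using A \<gamma> p(1)[OF n] unfolding subrepresentation_def by fastforce
        moreover have "act ?M \<gamma> (bvec n - p n) \<in> B (head Q \<gamma>)"
          using B \<gamma> p(2)[OF n] unfolding subrepresentation_def by fastforce
        moreover have "act ?M \<gamma> (bvec n - p n) = ?w - act ?M \<gamma> (p n)"
          by (rule poly_mapping_eqI)
            (simp add: lookup_tree_module_act[OF T] lookup_minus sum_subtractf)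
        \<comment> \<open>Applying \<gamma> to the components of \<open>v\<^sub>n\<close> gives the
          components of its image, by uniqueness.\<close>
        ultimately have ew: "?e ?w = act ?M \<gamma> (p n)"
          using e_unique[OF head w] by simp
        have "?l = Poly_Mapping.lookup (act ?M \<gamma> (p n)) k"
          by (simp add: lookup_tree_module_act[OF T] c_def)
        also have "\<dots> = (\<Sum>a | a \<in> arcs T \<and> snd F a = \<gamma>. c k (head T a) * of_bool (tail T a = n))"
          using k unfolding ew[symmetric] lookup_matrix_map_act[OF T] lookup_bvec by simp
        also have "\<dots> = ?r" by (rule sum.mono_neutral_cong_right) auto
        finally show ?thesis .
      next
        case False
        have arcs: "\<gamma> \<in> arcs Q \<and> tail Q \<gamma> = fst F (tail T a)" if "a \<in> arcs T" "snd F a = \<gamma>" for a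
          using F that unfolding quiver_morphism_def by metis
        have "?l = 0" by (rule sum.neutral) (use arcs False c_zero[OF n] in fastforce)
        moreover have "?r = 0" by (rule sum.neutral) (use arcs False in fastforce)
        ultimately show ?thesis by simp
      qed
    qed
    from trivial[OF this] show ?thesis
      unfolding trivial_matrix_def
    proof (elim disjE)
      assume "\<forall>k\<in>verts T. \<forall>n\<in>verts T. c k n = 0"
      then have e0: "?e x = 0" for x
        by (intro poly_mapping_eqI) (simp add: lookup_matrix_map[OF T])
      have "A y = {0}" if y: "y \<in> verts Q" for y
        using e_A[OF y] e0 vs.subspace_0[OF subA(1)[OF y]] by fastforce
      then show ?thesis by (simp add: zero_family_def)
    next
      assume c1: "\<forall>k\<in>verts T. \<forall>n\<in>verts T. c k n = of_bool (k = n)"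
      have e1: "?e x = x" if x: "x \<in> space_at ?M y" for x y
      proof (rule poly_mapping_eqI)
        fix k
        have "(\<Sum>n\<in>verts T. c k n * Poly_Mapping.lookup x n) =
            (\<Sum>n\<in>verts T. if k = n then Poly_Mapping.lookup x k else 0)" if "k \<in> verts T"
          using c1 that by (intro sum.cong) auto
        then show "Poly_Mapping.lookup (?e x) k = Poly_Mapping.lookup x k"
          using x by (auto simp: lookup_matrix_map[OF T] tree_module_space_iff)
      qed
      have "B y = {0}" if y: "y \<in> verts Q" for y
        using e_B[OF y] e1[of _ y] subB[OF y] vs.subspace_0[OF subB(1)[OF y]] by fastforce
      then show ?thesis by (simp add: zero_family_def)
    qed
  qed
  then show ?thesis using rep nonzero unfolding indecomposable_def by blast
qed

theorem theoremA:
  fixes Q :: "('v, 'a) pre_digraph"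
    and \<rho> :: "('v, 'a) path set"
    and T :: "('n, 'e) pre_digraph"
    and F :: "('n \<Rightarrow> 'v) \<times> ('e \<Rightarrow> 'a)"
  assumes "CHAR('k::field) \<noteq> 2"
    and "wf_digraph Q"
    and "zero_relations TYPE('k) Q \<rho>"
    and "rooted_tree T"
    and "bound_morphism TYPE('k) Q \<rho> T F"
  shows "indecomposable fscale Q \<rho> (tree_module T F :: ('v, 'a, 'n \<Rightarrow>\<^sub>0 'k) quiver_rep) \<longleftrightarrow>
    \<not> (\<exists>\<iota>. idempotent_morphism T \<iota> \<and> \<not> morphism_eq T \<iota> (id, id) \<and>
          morphism_eq T (morphism_comp F \<iota>) F)"
proof -
  have T: "fin_digraph T" "verts T \<noteq> {}" and F: "quiver_morphism T Q F"
    using assms(4,5) by (auto simp: rooted_tree_def quiver_tree_def bound_morphism_def)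
  have "indecomposable fscale Q \<rho> (tree_module T F :: ('v, 'a, 'n \<Rightarrow>\<^sub>0 'k) quiver_rep) \<longleftrightarrow>
      \<not> (\<exists>c :: 'n \<Rightarrow> 'n \<Rightarrow> 'k. idempotent_matrix T F c \<and> \<not> trivial_matrix T c)"
    using indecomposable_trivial_matrix[OF T(1) F] trivial_matrix_indecomposable[OF assms(2) T assms(5)] by blast
  also have "\<dots> \<longleftrightarrow> \<not> (\<exists>\<iota>. retraction T F \<iota> \<and> \<not> morphism_eq T \<iota> (id, id))"
    using rooted_tree_retraction_iff_idempotent_matrix[OF assms(4), of F, where ?'k = 'k] by simp
  finally show ?thesis by (simp only: retraction_def conj_ac)
qed

end
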